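(* Let $k\ge2$, $0\le\alpha<1$, let $G$ be a connected $k$-uniform hypergraph with at least one edge, and let $u\in V(G)$. For all integers $p\ge q\ge1$, \[\rho_\alpha(G_u(p,q))>\rho_\alpha(G_u(p+1,q-1)).\]
   Context: Hypergraphs are finite with edges being sets; $k$-uniform means every edge has $k$ vertices. $\mathcal A_\alpha(G)=\alpha\mathcal D(G)+(1-\alpha)\mathcal A(G)$, where $\mathcal A(G)$ is the order-$k$ tensor with $(i_1,\dots,i_k)$-entry $\frac1{(k-1)!}$ if $\{i_1,\dots,i_k\}\in E(G)$ and $0$ otherwise, and $\mathcal D(G)$ is the diagonal tensor of vertex degrees; for an order-$k$ tensor $\mathcal T$, $(\mathcal Tx)_i=\sum_{i_2,\dots,i_k}\mathcal T_{ii_2\dots i_k}x_{i_2}\cdots x_{i_k}$ and $\lambda$ is an eigenvalue if $\mathcal Tx=\lambda x^{[k-1]}$ for some $x\neq0$; $\rho_\alpha(G)$ is the largest modulus of an eigenvalue of $\mathcal A_\alpha(G)$. Connected: any two vertices are joined by a path. For a $k$-uniform hypergraph $H$, a vertex $u\in V(H)$ and $s\ge1$, $H_u(s)$ denotes the hypergraph obtained from $H$ by attaching a pendant loose path of length $s$ at $u$: add new vertices $w_1,\dots,w_s$ and new edges $f_1,\dots,f_s$, where $f_i$ consists of $w_{i-1},w_i$ (with $w_0=u$) and $k-2$ further new vertices, all new vertices being distinct and not in $V(H)$. Set $H_u(0)=H$. For $p\ge q\ge0$, $G_u(p,q)=(G_u(p))_u(q)$. *)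

theory Defs
  imports "HOL-Analysis.Analysis"
begin

text \<open>A k-uniform hypergraph on a finite vertex set V with edge set E (edges are sets).\<close>
definition k_uniform_hypergraph :: "nat \<Rightarrow> 'a set \<Rightarrow> 'a set set \<Rightarrow> bool" where
  "k_uniform_hypergraph k V E \<longleftrightarrow> finite V \<and> (\<forall>e\<in>E. e \<subseteq> V \<and> card e = k)"

text \<open>Connectedness: any two vertices are joined by a path, i.e. a sequence of vertices
  in which consecutive vertices lie in a common edge.\<close>
definition hg_adj :: "'a set set \<Rightarrow> ('a \<times> 'a) set" where
  "hg_adj E = {(x, y). \<exists>e\<in>E. x \<in> e \<and> y \<in> e}"

definition hg_connected :: "'a set \<Rightarrow> 'a set set \<Rightarrow> bool" where
  "hg_connected V E \<longleftrightarrow> (\<forall>x\<in>V. \<forall>y\<in>V. (x, y) \<in> (hg_adj E)\<^sup>*)"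

definition hg_degree :: "'a set set \<Rightarrow> 'a \<Rightarrow> nat" where
  "hg_degree E i = card {e\<in>E. i \<in> e}"

text \<open>An order-k tensor over V is represented as a function of the first index i and the
  remaining k-1 indices (i_2,...,i_k), given as a function f on {..<k-1}.\<close>
definition adj_tensor :: "nat \<Rightarrow> 'a set set \<Rightarrow> 'a \<Rightarrow> (nat \<Rightarrow> 'a) \<Rightarrow> real" where
  "adj_tensor k E i f = (if insert i (f ` {..<k-1}) \<in> E then 1 / fact (k - 1) else 0)"

definition deg_tensor :: "nat \<Rightarrow> 'a set set \<Rightarrow> 'a \<Rightarrow> (nat \<Rightarrow> 'a) \<Rightarrow> real" where
  "deg_tensor k E i f = (if \<forall>j<k-1. f j = i then real (hg_degree E i) else 0)"

definition A_alpha_tensor :: "nat \<Rightarrow> real \<Rightarrow> 'a set set \<Rightarrow> 'a \<Rightarrow> (nat \<Rightarrow> 'a) \<Rightarrow> real" where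
  "A_alpha_tensor k \<alpha> E i f = \<alpha> * deg_tensor k E i f + (1 - \<alpha>) * adj_tensor k E i f"

text \<open>(T x)_i = sum over i_2..i_k in V of T_{i i_2 .. i_k} x_{i_2} ... x_{i_k}.\<close>
definition tensor_apply ::
  "nat \<Rightarrow> 'a set \<Rightarrow> ('a \<Rightarrow> (nat \<Rightarrow> 'a) \<Rightarrow> real) \<Rightarrow> ('a \<Rightarrow> complex) \<Rightarrow> 'a \<Rightarrow> complex" where
  "tensor_apply k V T x i =
     (\<Sum>f\<in>PiE {..<k-1} (\<lambda>_. V). complex_of_real (T i f) * (\<Prod>j<k-1. x (f j)))"

definition tensor_eigenvalue ::
  "nat \<Rightarrow> 'a set \<Rightarrow> ('a \<Rightarrow> (nat \<Rightarrow> 'a) \<Rightarrow> real) \<Rightarrow> complex \<Rightarrow> bool" where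
  "tensor_eigenvalue k V T \<mu> \<longleftrightarrow>
     (\<exists>x. (\<exists>i\<in>V. x i \<noteq> 0) \<and> (\<forall>i\<in>V. tensor_apply k V T x i = \<mu> * x i ^ (k - 1)))"

definition rho_alpha :: "nat \<Rightarrow> real \<Rightarrow> 'a set \<Rightarrow> 'a set set \<Rightarrow> real" where
  "rho_alpha k \<alpha> V E = Sup {cmod \<mu> | \<mu>. tensor_eigenvalue k V (A_alpha_tensor k \<alpha> E) \<mu>}"

text \<open>Attaching a pendant loose path of length s at u. Old vertices are tagged Inl,
  new vertices are Inr (i, j) with 1 \<le> i \<le> s, 1 \<le> j \<le> k-1; w_i = Inr (i, 1), w_0 = Inl u,
  and f_i = {w_{i-1}} \<union> {Inr (i, j) | 1 \<le> j \<le> k-1}.\<close>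
definition path_edge :: "nat \<Rightarrow> 'a \<Rightarrow> nat \<Rightarrow> ('a + nat \<times> nat) set" where
  "path_edge k u i =
     insert (if i = 1 then Inl u else Inr (i - 1, 1)) {Inr (i, j) | j. 1 \<le> j \<and> j \<le> k - 1}"

definition attach_path_V :: "nat \<Rightarrow> 'a set \<Rightarrow> nat \<Rightarrow> ('a + nat \<times> nat) set" where
  "attach_path_V k V s = Inl ` V \<union> {Inr (i, j) | i j. 1 \<le> i \<and> i \<le> s \<and> 1 \<le> j \<and> j \<le> k - 1}"

definition attach_path_E :: "nat \<Rightarrow> 'a set set \<Rightarrow> 'a \<Rightarrow> nat \<Rightarrow> ('a + nat \<times> nat) set set" where
  "attach_path_E k E u s = (\<lambda>e. Inl ` e) ` E \<union> {path_edge k u i | i. 1 \<le> i \<and> i \<le> s}"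

text \<open>G_u(p,q) = (G_u(p))_u(q).\<close>
definition Gpq_V :: "nat \<Rightarrow> 'a set \<Rightarrow> nat \<Rightarrow> nat \<Rightarrow> (('a + nat \<times> nat) + nat \<times> nat) set" where
  "Gpq_V k V p q = attach_path_V k (attach_path_V k V p) q"

definition Gpq_E :: "nat \<Rightarrow> 'a set set \<Rightarrow> 'a \<Rightarrow> nat \<Rightarrow> nat \<Rightarrow> (('a + nat \<times> nat) + nat \<times> nat) set set" where
  "Gpq_E k E u p q = attach_path_E k (attach_path_E k E u p) (Inl u) q"

end

(*
For a connected uniform hypergraph, rho_alpha is the maximum of the form
  F x = sum over edges e of (alpha * sum_{i in e} x_i^k + (1 - alpha) k prod_{i in e} x_i)
over nonnegative x with sum x_i^k = 1, and the maximum is attained at a positive vector.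

View G_u(s,t) as G glued at position t to a path with vertices c_0, ..., c_N, N = s + t.  So
G_u(p+1,q-1) has its root at position m = q - 1; gluing G at position p of the same path gives
G_u(p,q).  Take the positive maximizer of G_u(p+1,q-1) and compare c_l with c_{N-1-l}.
If c_m <= c_p, move G from c_m to c_p.  Otherwise take the least L with c_L > c_{N-1-L} and
reverse the segment from L to N-1-L, which carries the root from m to p.  Neither step decreases F
or changes the norm.  Equality is excluded by varying one coordinate: the original vector is a
critical point, whereas the gain of the surgery has negative derivative there.
*)
theory Submission
  imports Defs
begin

subsection \<open>The adjacency tensor\<close>

text \<open>The reflection \<open>l -> N - 1 - l\<close> is forced by \<open>m + p = N - 1\<close>:
  it exchanges the two root positions and leaves the last vertex \<open>c_N\<close> unpaired. When
  \<open>c_m > c_p\<close> the index \<open>m\<close> itself qualifies, so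
  \<open>L \<le> m < p\<close> and the segment from \<open>L\<close> to \<open>M = N - 1 - L\<close>
  contains both positions. Reversal alters only the edges that leave the segment:
  \<open>c_(L-1)\<close> gets the neighbour \<open>c_M\<close> instead of \<open>c_L\<close>, and
  \<open>c_(M+1)\<close> gets \<open>c_L\<close> instead of \<open>c_M\<close>. Minimality of
  \<open>L\<close> gives \<open>c_(L-1) \<le> c_(M+1)\<close>, so the larger end meets the larger
  outer neighbour, as in the rearrangement inequality. For \<open>k > 2\<close> the interior
  vertices add a further factor to each of these edges, which may favour the wrong side; the
  interiors are then exchanged as well. Ties such as \<open>c_m = c_p\<close> or
  \<open>c_(L-1) = c_(M+1)\<close> can make the gain vanish. The coordinate varied against this is
  \<open>c_m\<close> when the root is moved and \<open>c_(L-1)\<close> when a segment is reversed;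
  for \<open>L = 0\<close> the gain is strict without variation.\<close>

lemma finite_edges:
  assumes "k_uniform_hypergraph k V E" shows "finite E"
  using assms unfolding k_uniform_hypergraph_def
  by (meson Pow_iff finite_Pow_iff finite_subset subsetI)

lemma edge_finite:
  assumes "k_uniform_hypergraph k V E" "e \<in> E" shows "finite e"
  using assms unfolding k_uniform_hypergraph_def by (meson finite_subset)

text \<open>The partial derivative at \<open>i\<close> of the sum of the edge monomials.\<close>

definition link_sum :: "'b set set \<Rightarrow> 'b \<Rightarrow> ('b \<Rightarrow> 'c::comm_semiring_1) \<Rightarrow> 'c" where
  "link_sum E i x = (\<Sum>e | e \<in> E \<and> i \<in> e. \<Prod>j\<in>e - {i}. x j)"

text \<open>Counts the orderings of the remaining vertices of an edge; this number cancels the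
  weight \<open>1 / fact (k - 1)\<close> of the adjacency tensor.\<close>

lemma card_extensional_inj:
  assumes "finite C"
  shows "card {f \<in> {..<card C} \<rightarrow>\<^sub>E C. inj_on f {..<card C}} = fact (card C)"
proof -
  have "prod ((-) (card C)) {0..<card C} = fact (card C)"
    by (simp add: fact_prod_rev)
  then show ?thesis
    using card_inj_on_subset_funcset[of "{..<card C}" C "{..<card C}"] assms by simp
qed

text \<open>An index tuple meets the entry of an edge \<open>e\<close> only if its
  \<open>k - 1\<close> values together with \<open>i\<close> fill the \<open>k\<close> vertices of
  \<open>e\<close>. It therefore lists \<open>e - {i}\<close> without repetition, and all such lists
  give the same product.\<close>

lemma tensor_apply_A_alpha:
  fixes x :: "'b \<Rightarrow> complex"
  assumes G: "k_uniform_hypergraph k V E" and k: "k \<ge> 2" and i: "i \<in> V"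
  shows "tensor_apply k V (A_alpha_tensor k \<alpha> E) x i =
    of_real (\<alpha> * real (hg_degree E i)) * x i ^ (k - 1) + of_real (1 - \<alpha>) * link_sum E i x"
proof -
  let ?P = "PiE {..<k-1} (\<lambda>_. V)"
  have finV: "finite V" using G unfolding k_uniform_hypergraph_def by auto
  have finP: "finite ?P" using finV by (intro finite_PiE) auto
  have finE: "finite E" by (rule finite_edges[OF G])
  define c where "c = restrict (\<lambda>_. i) {..<k-1}"
  have cP: "c \<in> ?P" using i by (auto simp: c_def)
  have c_eq: "(\<forall>j<k-1. f j = i) \<longleftrightarrow> f = c" if "f \<in> ?P" for f
  proof
    assume "\<forall>j<k-1. f j = i"
    then show "f = c" using that cP
      by (intro PiE_ext) (auto simp: c_def)
  qed (auto simp: c_def)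
  have deg: "(\<Sum>f\<in>?P. complex_of_real (deg_tensor k E i f) * (\<Prod>j<k-1. x (f j)))
     = of_real (real (hg_degree E i)) * x i ^ (k - 1)"
  proof -
    have "(\<Sum>f\<in>?P. complex_of_real (deg_tensor k E i f) * (\<Prod>j<k-1. x (f j)))
      = (\<Sum>f\<in>?P. if f = c then of_real (real (hg_degree E i)) * (\<Prod>j<k-1. x (c j)) else 0)"
      by (intro sum.cong refl, unfold deg_tensor_def, subst c_eq) auto
    also have "\<dots> = of_real (real (hg_degree E i)) * (\<Prod>j<k-1. x (c j))"
      using finP cP by simp
    also have "(\<Prod>j<k-1. x (c j)) = x i ^ (k - 1)"
      by (simp add: c_def)
    finally show ?thesis .
  qed
  have edge: "(\<Sum>f | f \<in> ?P \<and> insert i (f ` {..<k-1}) = e. \<Prod>j<k-1. x (f j))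
      = (if i \<in> e then fact (k - 1) * (\<Prod>j\<in>e - {i}. x j) else 0)" if e: "e \<in> E" for e
  proof (cases "i \<in> e")
    case False
    then have "{f. f \<in> ?P \<and> insert i (f ` {..<k-1}) = e} = {}" by auto
    then show ?thesis using False by (simp only: sum.empty if_False)
  next
    case True
    have ek: "card e = k" "e \<subseteq> V" "finite e"
      using G e edge_finite[OF G e] unfolding k_uniform_hypergraph_def by auto
    have ck: "card (e - {i}) = k - 1" using True ek by simp
    have bij: "f ` {..<k-1} = e - {i} \<and> inj_on f {..<k-1}"
      if "insert i (f ` {..<k-1}) = e" for f
    proof -
      have "k \<le> card (insert i (f ` {..<k-1}))" using that ek by simp
      moreover have c1: "card (f ` {..<k-1}) \<le> k - 1"
        by (metis card_image_le card_lessThan finite_lessThan)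
      ultimately have ni: "i \<notin> f ` {..<k-1}" using k
        by (auto simp: insert_absorb)
      have "card (f ` {..<k-1}) = k - 1" using that ni ck by auto
      then have "inj_on f {..<k-1}" by (intro eq_card_imp_inj_on) auto
      then show ?thesis using that ni by auto
    qed
    have set_eq: "{f. f \<in> ?P \<and> insert i (f ` {..<k-1}) = e} =
        {f \<in> {..<card (e - {i})} \<rightarrow>\<^sub>E (e - {i}). inj_on f {..<card (e - {i})}}"
      (is "?L = ?R")
    proof (intro equalityI subsetI)
      fix f assume "f \<in> ?L"
      then show "f \<in> ?R" using bij[of f] ck by (auto simp: PiE_iff)
    next
      fix f assume f: "f \<in> ?R"
      then have "f ` {..<k-1} \<subseteq> e - {i}" "card (f ` {..<k-1}) = card (e - {i})"
        using ck by (auto simp: card_image)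
      then have "f ` {..<k-1} = e - {i}" using ek by (intro card_subset_eq) auto
      then show "f \<in> ?L" using f ck ek True by (auto simp: PiE_iff)
    qed
    have "(\<Sum>f | f \<in> ?P \<and> insert i (f ` {..<k-1}) = e. \<Prod>j<k-1. x (f j))
      = (\<Sum>f | f \<in> ?P \<and> insert i (f ` {..<k-1}) = e. \<Prod>j\<in>e - {i}. x j)"
    proof (intro sum.cong refl)
      fix f assume "f \<in> {f. f \<in> ?P \<and> insert i (f ` {..<k-1}) = e}"
      with bij[of f] have "f ` {..<k-1} = e - {i}" "inj_on f {..<k-1}" by auto
      then show "(\<Prod>j<k-1. x (f j)) = (\<Prod>j\<in>e - {i}. x j)"
        by (metis (no_types, lifting) prod.reindex_cong)
    qed
    also have "\<dots> = fact (k - 1) * (\<Prod>j\<in>e - {i}. x j)"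
      unfolding set_eq using card_extensional_inj[of "e - {i}"] ek ck by simp
    finally show ?thesis using True by simp
  qed
  have "(\<Sum>f\<in>?P. complex_of_real (adj_tensor k E i f) * (\<Prod>j<k-1. x (f j)))
     = (\<Sum>f\<in>?P. \<Sum>e\<in>E. if insert i (f ` {..<k-1}) = e then (\<Prod>j<k-1. x (f j)) / fact (k - 1) else 0)"
    by (intro sum.cong refl) (use finE in \<open>auto simp: adj_tensor_def\<close>)
  also have "\<dots> = (\<Sum>e\<in>E. \<Sum>f\<in>?P. if insert i (f ` {..<k-1}) = e then (\<Prod>j<k-1. x (f j)) / fact (k - 1) else 0)"
    by (rule sum.swap)
  also have "\<dots> = (\<Sum>e\<in>E. (\<Sum>f | f \<in> ?P \<and> insert i (f ` {..<k-1}) = e. \<Prod>j<k-1. x (f j)) / fact (k - 1))"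
    unfolding sum_divide_distrib
    by (simp only: sum.inter_filter[OF finP])
  also have "\<dots> = (\<Sum>e\<in>E. if i \<in> e then (\<Prod>j\<in>e - {i}. x j) else 0)"
    by (intro sum.cong refl) (use edge in auto)
  also have "\<dots> = link_sum E i x"
    unfolding link_sum_def using finE by (simp add: sum.inter_filter)
  finally have adj: "(\<Sum>f\<in>?P. complex_of_real (adj_tensor k E i f) * (\<Prod>j<k-1. x (f j))) = link_sum E i x" .
  have "tensor_apply k V (A_alpha_tensor k \<alpha> E) x i =
      of_real \<alpha> * (\<Sum>f\<in>?P. complex_of_real (deg_tensor k E i f) * (\<Prod>j<k-1. x (f j)))
     + of_real (1 - \<alpha>) * (\<Sum>f\<in>?P. complex_of_real (adj_tensor k E i f) * (\<Prod>j<k-1. x (f j)))"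
    unfolding tensor_apply_def A_alpha_tensor_def sum_distrib_left sum.distrib[symmetric]
    by (intro sum.cong refl) (simp add: algebra_simps)
  then show ?thesis unfolding deg adj by simp
qed

subsection \<open>The variational characterization of the spectral radius\<close>

locale alpha_form =
  fixes k :: nat and \<alpha> :: real
  assumes k2: "k \<ge> 2" and \<alpha>0: "0 \<le> \<alpha>" and \<alpha>1: "\<alpha> < 1"
begin

text \<open>The share of one edge in \<open>sum_i x_i (A_\<alpha> x)_i\<close>: its product arises
  once from each of its \<open>k\<close> vertices, whence the factor \<open>k\<close>.\<close>

definition edge_form :: "('b \<Rightarrow> real) \<Rightarrow> 'b set \<Rightarrow> real" where
  "edge_form x e = \<alpha> * (\<Sum>i\<in>e. x i ^ k) + (1 - \<alpha>) * real k * (\<Prod>i\<in>e. x i)"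

definition form :: "'b set set \<Rightarrow> ('b \<Rightarrow> real) \<Rightarrow> real" where
  "form E x = (\<Sum>e\<in>E. edge_form x e)"

definition knorm :: "'b set \<Rightarrow> ('b \<Rightarrow> real) \<Rightarrow> real" where
  "knorm V x = (\<Sum>v\<in>V. x v ^ k)"

lemma edge_form_cong: "(\<And>i. i \<in> e \<Longrightarrow> x i = y i) \<Longrightarrow> edge_form x e = edge_form y e"
  unfolding edge_form_def by (auto cong: sum.cong prod.cong)

lemma form_cong:
  assumes "k_uniform_hypergraph k V E" "\<And>i. i \<in> V \<Longrightarrow> x i = y i"
  shows "form E x = form E y"
  unfolding form_def
  by (intro sum.cong refl edge_form_cong)
    (use assms in \<open>auto simp: k_uniform_hypergraph_def subset_iff\<close>)

lemma knorm_cong: "(\<And>i. i \<in> V \<Longrightarrow> x i = y i) \<Longrightarrow> knorm V x = knorm V y"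
  unfolding knorm_def by (auto cong: sum.cong)

lemma knorm_nonneg: "(\<And>v. v \<in> V \<Longrightarrow> 0 \<le> x v) \<Longrightarrow> 0 \<le> knorm V x"
  unfolding knorm_def by (auto intro: sum_nonneg)

lemma knorm_pos: "finite V \<Longrightarrow> V \<noteq> {} \<Longrightarrow> (\<And>v. v \<in> V \<Longrightarrow> 0 < x v) \<Longrightarrow> 0 < knorm V x"
  unfolding knorm_def by (auto intro: sum_pos)

lemma edge_form_mono:
  assumes "\<And>i. i \<in> e \<Longrightarrow> 0 \<le> x i" "\<And>i. i \<in> e \<Longrightarrow> x i \<le> y i"
  shows "edge_form x e \<le> edge_form y e"
  unfolding edge_form_def
  using assms \<alpha>0 \<alpha>1 by (intro add_mono mult_left_mono sum_mono prod_mono power_mono) auto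

lemma edge_form_scale:
  assumes "card e = k"
  shows "edge_form (\<lambda>i. c * x i) e = c ^ k * edge_form x e"
  using assms unfolding edge_form_def
  by (simp add: power_mult_distrib prod.distrib sum_distrib_left algebra_simps)

lemma edge_form_upd:
  assumes "finite e"
  shows "edge_form (x(i := t)) e - edge_form x e =
    (if i \<in> e then \<alpha> * (t ^ k - x i ^ k) + (1 - \<alpha>) * real k * ((t - x i) * (\<Prod>j\<in>e - {i}. x j)) else 0)"
proof (cases "i \<in> e")
  case True
  have "(\<Sum>j\<in>e - {i}. (x(i := t)) j ^ k) = (\<Sum>j\<in>e - {i}. x j ^ k)"
    "(\<Prod>j\<in>e - {i}. (x(i := t)) j) = (\<Prod>j\<in>e - {i}. x j)"
    by (auto intro!: sum.cong prod.cong)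
  then show ?thesis using True
    unfolding edge_form_def sum.remove[OF assms True] prod.remove[OF assms True]
    by (simp add: algebra_simps)
next
  case False
  then have "edge_form (x(i := t)) e = edge_form x e" by (intro edge_form_cong) auto
  then show ?thesis using False by simp
qed

text \<open>Every edge product is affine in a single coordinate, so the change is given exactly and
  not only to first order.\<close>

lemma form_upd:
  assumes "finite E" "\<And>e. e \<in> E \<Longrightarrow> finite e"
  shows "form E (x(i := t)) - form E x =
    \<alpha> * real (hg_degree E i) * (t ^ k - x i ^ k) + (1 - \<alpha>) * real k * (t - x i) * link_sum E i x"
proof -
  have "form E (x(i := t)) - form E x = (\<Sum>e\<in>E. if i \<in> e then
      \<alpha> * (t ^ k - x i ^ k) + (1 - \<alpha>) * real k * ((t - x i) * (\<Prod>j\<in>e - {i}. x j)) else 0)"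
    unfolding form_def sum_subtractf[symmetric]
    by (intro sum.cong refl edge_form_upd assms)
  also have "\<dots> = (\<Sum>e | e \<in> E \<and> i \<in> e.
      \<alpha> * (t ^ k - x i ^ k) + (1 - \<alpha>) * real k * ((t - x i) * (\<Prod>j\<in>e - {i}. x j)))"
    using assms by (simp add: sum.inter_filter)
  finally show ?thesis
    unfolding link_sum_def hg_degree_def by (simp add: sum.distrib sum_distrib_left mult_ac)
qed

lemma knorm_upd:
  assumes "finite V" "i \<in> V"
  shows "knorm V (x(i := t)) - knorm V x = t ^ k - x i ^ k"
proof -
  have "(\<Sum>j\<in>V - {i}. (x(i := t)) j ^ k) = (\<Sum>j\<in>V - {i}. x j ^ k)"
    by (auto intro!: sum.cong)
  then show ?thesis
    unfolding knorm_def sum.remove[OF assms] by simp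
qed

text \<open>Double counting of vertex-edge incidences. The right side is the shape obtained by
  multiplying the eigenvalue equation at \<open>i\<close> by \<open>x i\<close> and summing.\<close>

lemma form_eq_link_sum:
  assumes "k_uniform_hypergraph k V E"
  shows "form E x = (\<Sum>i\<in>V. \<alpha> * real (hg_degree E i) * x i ^ k + (1 - \<alpha>) * (x i * link_sum E i x))"
proof -
  have finV: "finite V" and finE: "finite E"
    using assms finite_edges unfolding k_uniform_hypergraph_def by auto
  have "edge_form x e = (\<Sum>i\<in>V. if i \<in> e then \<alpha> * x i ^ k + (1 - \<alpha>) * (x i * (\<Prod>j\<in>e - {i}. x j)) else 0)"
    if "e \<in> E" for e
  proof -
    have e: "e \<subseteq> V" "card e = k" "finite e"
      using that assms edge_finite unfolding k_uniform_hypergraph_def by auto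
    have "(\<Sum>i\<in>V. if i \<in> e then \<alpha> * x i ^ k + (1 - \<alpha>) * (x i * (\<Prod>j\<in>e - {i}. x j)) else 0)
       = (\<Sum>i\<in>e. \<alpha> * x i ^ k + (1 - \<alpha>) * (x i * (\<Prod>j\<in>e - {i}. x j)))"
      using e finV by (simp add: sum.inter_restrict[symmetric] Int_absorb1)
    also have "\<dots> = (\<Sum>i\<in>e. \<alpha> * x i ^ k + (1 - \<alpha>) * (\<Prod>j\<in>e. x j))"
      using e by (intro sum.cong refl) (simp add: prod.remove)
    also have "\<dots> = edge_form x e"
      using e unfolding edge_form_def by (simp add: sum.distrib sum_distrib_left)
    finally show ?thesis by simp
  qed
  then have "form E x = (\<Sum>e\<in>E. \<Sum>i\<in>V. if i \<in> e then \<alpha> * x i ^ k + (1 - \<alpha>) * (x i * (\<Prod>j\<in>e - {i}. x j)) else 0)"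
    unfolding form_def by (intro sum.cong refl) auto
  also have "\<dots> = (\<Sum>i\<in>V. \<Sum>e\<in>E. if i \<in> e then \<alpha> * x i ^ k + (1 - \<alpha>) * (x i * (\<Prod>j\<in>e - {i}. x j)) else 0)"
    by (rule sum.swap)
  also have "\<dots> = (\<Sum>i\<in>V. \<Sum>e | e \<in> E \<and> i \<in> e. \<alpha> * x i ^ k + (1 - \<alpha>) * (x i * (\<Prod>j\<in>e - {i}. x j)))"
    by (simp add: sum.inter_filter finE)
  finally show ?thesis
    unfolding link_sum_def hg_degree_def by (simp add: sum.distrib sum_distrib_left mult_ac)
qed

text \<open>A homogeneous bound, so that test vectors need no normalization. It does not say that
  \<open>R\<close> is least; a positive vector attaining equality settles that.\<close>

definition form_bound :: "'b set \<Rightarrow> 'b set set \<Rightarrow> real \<Rightarrow> bool" where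
  "form_bound V E R \<longleftrightarrow> (\<forall>x. (\<forall>v\<in>V. 0 \<le> x v) \<longrightarrow> form E x \<le> R * knorm V x)"

lemma ex_form_maximizer:
  assumes G: "k_uniform_hypergraph k V E" and ne: "V \<noteq> {}"
  obtains R x where "form_bound V E R" "\<And>v. 0 \<le> x v" "knorm V x = 1" "form E x = R"
proof -
  have finV: "finite V" using G unfolding k_uniform_hypergraph_def by auto
  have k0: "k > 0" using k2 by simp
  \<comment> \<open>The vertex type may be infinite. Pinning the coordinates outside
    \<open>V\<close> to 0 gives a box that is compact in the product topology by Tychonoff.\<close>
  let ?B = "PiE UNIV (\<lambda>v. if v \<in> V then {0..1::real} else {0})"
  define S where "S = ?B \<inter> {x. knorm V x = 1}"
  have cB: "compact ?B"
    using compactin_PiE[of "\<lambda>_::'a. euclidean :: real topology" UNIV "\<lambda>v. if v \<in> V then {0..1::real} else {0}"]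
    unfolding euclidean_product_topology by (auto simp: compactin_euclidean_iff)
  have cont_norm: "continuous_on UNIV (\<lambda>x. knorm V x)"
    unfolding knorm_def by (intro continuous_intros) auto
  have cont_form: "continuous_on UNIV (\<lambda>x. form E x)"
    unfolding form_def edge_form_def by (intro continuous_intros) auto
  have "closed {x. knorm V x = 1}"
    using continuous_closed_preimage_constant[OF cont_norm closed_UNIV, of 1] by simp
  then have cS: "compact S" unfolding S_def using cB by blast
  obtain w where w: "w \<in> V" using ne by auto
  have "(\<lambda>v. if v = w then 1 else 0) \<in> S"
    using w finV k0 by (auto simp: S_def knorm_def power_0_left if_distrib[of "\<lambda>t. t ^ k"] cong: if_cong)
  then have "S \<noteq> {}" by auto
  from continuous_attains_sup[OF cS this continuous_on_subset[OF cont_form subset_UNIV]]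
  obtain x where x: "x \<in> S" "\<And>y. y \<in> S \<Longrightarrow> form E y \<le> form E x" by auto
  have x0: "0 \<le> x v" for v
  proof -
    have "x v \<in> (if v \<in> V then {0..1} else {0})" using x(1) unfolding S_def by blast
    then show ?thesis by (auto split: if_splits)
  qed
  have "form_bound V E (form E x)"
    unfolding form_bound_def
  proof (intro allI impI)
    fix y :: "'a \<Rightarrow> real" assume y: "\<forall>v\<in>V. 0 \<le> y v"
    show "form E y \<le> form E x * knorm V y"
    proof (cases "knorm V y = 0")
      case True
      then have y0: "y v = 0" if "v \<in> V" for v
        using that y finV k0 unfolding knorm_def by (subst (asm) sum_nonneg_eq_0_iff) auto
      have "edge_form y e = 0" if "e \<in> E" for e
      proof -
        have e: "e \<subseteq> V" "card e = k" "finite e"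
          using that G edge_finite unfolding k_uniform_hypergraph_def by auto
        then have "e \<noteq> {}" using k0 by auto
        then have "(\<Sum>i\<in>e. y i ^ k) = 0" "(\<Prod>i\<in>e. y i) = 0"
          using e y0 k0 by (auto intro!: sum.neutral simp: subset_iff)
        then show ?thesis unfolding edge_form_def by simp
      qed
      then show ?thesis using True by (simp add: form_def)
    next
      case False
      define n where "n = knorm V y"
      have n: "n > 0" using False knorm_nonneg[of V y] y unfolding n_def by auto
      define c where "c = 1 / root k n"
      have c: "c > 0" "c ^ k * n = 1"
        using n k0 by (auto simp: c_def power_divide)
      define z where "z = (\<lambda>v. if v \<in> V then c * y v else 0)"
      have nz: "knorm V z = 1"
        using c unfolding z_def knorm_def n_def
        by (simp add: power_mult_distrib sum_distrib_left)
      have z0: "0 \<le> z v" for v using y c by (auto simp: z_def)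
      have z1: "z v \<le> 1" if "v \<in> V" for v
      proof -
        have "z v ^ k \<le> knorm V z"
          unfolding knorm_def using finV that z0 by (intro member_le_sum) auto
        then show ?thesis using nz z0[of v] k0 by (simp add: power_le_one_iff)
      qed
      have "z v \<in> (if v \<in> V then {0..1} else {0})" for v
        using z0[of v] z1[of v] by (cases "v \<in> V") (auto simp: z_def)
      then have "z \<in> S" using nz by (simp add: S_def PiE_iff)
      from x(2)[OF this] have "form E z \<le> form E x" .
      moreover have "form E z = c ^ k * form E y"
      proof -
        have "form E z = form E (\<lambda>v. c * y v)"
          by (intro form_cong[OF G]) (simp add: z_def)
        also have "\<dots> = c ^ k * form E y"
          unfolding form_def sum_distrib_left
          by (intro sum.cong refl edge_form_scale) (use G in \<open>auto simp: k_uniform_hypergraph_def\<close>)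
        finally show ?thesis .
      qed
      ultimately have "c ^ k * form E y * n \<le> form E x * n" using n by simp
      moreover have "c ^ k * form E y * n = (c ^ k * n) * form E y" by simp
      ultimately show ?thesis using c unfolding n_def[symmetric] by simp
    qed
  qed
  then show ?thesis using that x0 x(1) unfolding S_def by blast
qed

text \<open>Replacing the zero entries by \<open>\<epsilon>\<close> gains order \<open>\<epsilon> ^ (k - 1)\<close> on an edge that meets both the
  support and its complement, but costs only order \<open>\<epsilon> ^ k\<close> in the norm.\<close>

lemma maximizer_pos:
  assumes G: "k_uniform_hypergraph k V E" and conn: "hg_connected V E"
    and R: "form_bound V E R" and x0: "\<And>v. 0 \<le> x v" and n1: "knorm V x = 1"
    and eq: "form E x = R" and v: "v \<in> V"
  shows "x v > 0"
proof (rule ccontr)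
  assume "\<not> x v > 0"
  then have xv: "x v = 0" using x0[of v] by simp
  have finV: "finite V" and finE: "finite E" and k0: "k > 0"
    using G finite_edges k2 unfolding k_uniform_hypergraph_def by auto
  have "\<exists>w\<in>V. x w \<noteq> 0"
  proof (rule ccontr)
    assume "\<not> (\<exists>w\<in>V. x w \<noteq> 0)"
    then have "knorm V x = 0" using k0 by (simp add: knorm_def)
    then show False using n1 by simp
  qed
  then obtain w where w: "w \<in> V" "x w \<noteq> 0" by auto
  have "(w, v) \<in> (hg_adj E)\<^sup>*" using conn w v unfolding hg_connected_def by auto
  \<comment> \<open>A path from the support of \<open>x\<close> to the zero \<open>v\<close> must
    leave the support at some step.\<close>
  then have "\<exists>a b. (a, b) \<in> hg_adj E \<and> x a \<noteq> 0 \<and> x b = 0"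
    using w xv by (induction rule: rtrancl_induct) auto
  then obtain a b e0 where ab: "e0 \<in> E" "a \<in> e0" "b \<in> e0" "x a \<noteq> 0" "x b = 0"
    unfolding hg_adj_def by auto
  have e0: "e0 \<subseteq> V" "card e0 = k" "finite e0"
    using ab G edge_finite unfolding k_uniform_hypergraph_def by auto
  define y where "y \<epsilon> v = (if x v = 0 then \<epsilon> else x v)" for \<epsilon> v
  define c where "c = (\<Prod>i | i \<in> e0 \<and> x i \<noteq> 0. x i)"
  have c: "c > 0" unfolding c_def using x0 by (intro prod_pos) (auto simp: less_le)
  define m where "m = card {v\<in>V. x v = 0}"
  have key: "(1 - \<alpha>) * real k * c \<le> R * real m * \<epsilon>" if \<epsilon>: "0 < \<epsilon>" "\<epsilon> < 1" for \<epsilon>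
  proof -
    have y0: "0 \<le> y \<epsilon> i" "x i \<le> y \<epsilon> i" for i using x0[of i] \<epsilon> by (auto simp: y_def)
    have "knorm V (y \<epsilon>) = (\<Sum>v\<in>V. x v ^ k + (if x v = 0 then \<epsilon> ^ k else 0))"
      unfolding knorm_def y_def using k0 by (intro sum.cong) auto
    also have "\<dots> = 1 + real m * \<epsilon> ^ k"
      using n1 finV by (simp add: sum.distrib knorm_def m_def flip: sum.inter_filter)
    finally have ny: "knorm V (y \<epsilon>) = 1 + real m * \<epsilon> ^ k" .
    have "edge_form x e0 + (1 - \<alpha>) * real k * (c * \<epsilon> ^ (k - 1)) \<le> edge_form (y \<epsilon>) e0"
    proof -
      have "(\<Prod>i\<in>e0. x i) = 0" using ab e0 by auto
      moreover have "c * \<epsilon> ^ (k - 1) \<le> (\<Prod>i\<in>e0. y \<epsilon> i)"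
      proof -
        have "(\<Prod>i\<in>e0. y \<epsilon> i) = (\<Prod>i\<in>e0. (if x i \<noteq> 0 then x i else 1) * (if x i = 0 then \<epsilon> else 1))"
          by (intro prod.cong) (auto simp: y_def)
        also have "\<dots> = c * \<epsilon> ^ card {i \<in> e0. x i = 0}"
          unfolding prod.distrib c_def using e0 by (simp flip: prod.inter_filter)
        finally have p: "(\<Prod>i\<in>e0. y \<epsilon> i) = c * \<epsilon> ^ card {i \<in> e0. x i = 0}" .
        \<comment> \<open>Since \<open>a\<close> lies in the support, at most \<open>k - 1\<close>
          factors equal \<open>\<epsilon>\<close>; as \<open>\<epsilon> < 1\<close>, the product is
          at least \<open>c * \<epsilon> ^ (k - 1)\<close>.\<close>
        have "{i \<in> e0. x i = 0} \<subset> e0" using ab by auto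
        from psubset_card_mono[OF e0(3) this]
        have "card {i \<in> e0. x i = 0} \<le> k - 1" using e0(2) by linarith
        then have "\<epsilon> ^ (k - 1) \<le> \<epsilon> ^ card {i \<in> e0. x i = 0}"
          using \<epsilon> by (intro power_decreasing) auto
        then show ?thesis unfolding p using c by simp
      qed
      moreover have "(\<Sum>i\<in>e0. x i ^ k) \<le> (\<Sum>i\<in>e0. y \<epsilon> i ^ k)"
        using y0 x0 by (intro sum_mono power_mono) auto
      ultimately show ?thesis unfolding edge_form_def using \<alpha>0 \<alpha>1
        by (simp add: add_mono mult_left_mono)
    qed
    moreover have "(\<Sum>e\<in>E - {e0}. edge_form x e) \<le> (\<Sum>e\<in>E - {e0}. edge_form (y \<epsilon>) e)"
      using y0 x0 by (intro sum_mono edge_form_mono) auto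
    ultimately have "R + (1 - \<alpha>) * real k * (c * \<epsilon> ^ (k - 1)) \<le> form E (y \<epsilon>)"
      unfolding eq[symmetric] form_def sum.remove[OF finE ab(1)] by simp
    also have "\<dots> \<le> R * knorm V (y \<epsilon>)" using R y0 unfolding form_bound_def by auto
    finally have "(1 - \<alpha>) * real k * (c * \<epsilon> ^ (k - 1)) \<le> R * (real m * \<epsilon> ^ k)"
      unfolding ny by (simp add: algebra_simps)
    also have "\<epsilon> ^ k = \<epsilon> * \<epsilon> ^ (k - 1)" using k0 by (simp add: power_eq_if)
    finally have "((1 - \<alpha>) * real k * c) * \<epsilon> ^ (k - 1) \<le> (R * real m * \<epsilon>) * \<epsilon> ^ (k - 1)"
      by (simp add: algebra_simps)
    then show ?thesis using \<epsilon> by simp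
  qed
  define d where "d = (1 - \<alpha>) * real k * c"
  have d: "d > 0" unfolding d_def using \<alpha>1 k0 c by simp
  \<comment> \<open>Chosen so that the right side of \<open>key\<close> is at most
    \<open>d / 2\<close>; the added 1 keeps the denominator positive.\<close>
  define \<epsilon> where "\<epsilon> = min (1/2) (d / (2 * (\<bar>R * real m\<bar> + 1)))"
  have \<epsilon>: "0 < \<epsilon>" "\<epsilon> < 1" "\<epsilon> \<le> d / (2 * (\<bar>R * real m\<bar> + 1))"
    unfolding \<epsilon>_def using d by auto
  have "d \<le> R * real m * \<epsilon>" using key[OF \<epsilon>(1,2)] unfolding d_def .
  also have "\<dots> \<le> (\<bar>R * real m\<bar> + 1) * \<epsilon>" using \<epsilon> by (intro mult_right_mono) auto
  also have "\<dots> \<le> (\<bar>R * real m\<bar> + 1) * (d / (2 * (\<bar>R * real m\<bar> + 1)))"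
    using \<epsilon> by (intro mult_left_mono) auto
  also have "\<dots> = d / 2" by (simp add: field_simps)
  finally show False using d by simp
qed

text \<open>The slack \<open>R * knorm V - form E\<close> is nonnegative on nonnegative vectors and
  vanishes at \<open>x\<close>, so it has a local minimum in each positive coordinate. The first
  conclusion is the eigenvalue equation, the second serves the strictness argument.\<close>

lemma maximizer_critical:
  assumes G: "k_uniform_hypergraph k V E" and R: "form_bound V E R"
    and x0: "\<And>v. v \<in> V \<Longrightarrow> 0 \<le> x v" and eq: "form E x = R * knorm V x"
    and i: "i \<in> V" and xi: "x i > 0"
  shows "(R - \<alpha> * real (hg_degree E i)) * x i ^ (k - 1) = (1 - \<alpha>) * link_sum E i x"
    and "((\<lambda>t. R * knorm V (x(i := t)) - form E (x(i := t))) has_real_derivative 0) (at (x i))"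
proof -
  have finV: "finite V" and finE: "finite E" and k0: "k > 0"
    using G finite_edges k2 unfolding k_uniform_hypergraph_def by auto
  let ?s = "\<lambda>t. R * knorm V (x(i := t)) - form E (x(i := t))"
  let ?D = "real k * ((R - \<alpha> * real (hg_degree E i)) * x i ^ (k - 1) - (1 - \<alpha>) * link_sum E i x)"
  have s: "?s t = (R - \<alpha> * real (hg_degree E i)) * (t ^ k - x i ^ k)
      - (1 - \<alpha>) * real k * (t - x i) * link_sum E i x" for t
  proof -
    have 1: "knorm V (x(i := t)) = knorm V x + (t ^ k - x i ^ k)"
      using knorm_upd[OF finV i, of x t] by simp
    have 2: "form E (x(i := t)) = form E x + (\<alpha> * real (hg_degree E i) * (t ^ k - x i ^ k)
        + (1 - \<alpha>) * real k * (t - x i) * link_sum E i x)"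
      using form_upd[OF finE edge_finite[OF G], of x i t] by simp
    show ?thesis unfolding 1 2 eq by (simp add: algebra_simps)
  qed
  have der: "(?s has_real_derivative ?D) (at (x i))"
    unfolding s by (auto intro!: derivative_eq_intros simp: algebra_simps)
  have "?D = 0"
  proof (rule DERIV_local_min[OF der])
    show "0 < x i" by fact
    show "\<forall>y. \<bar>x i - y\<bar> < x i \<longrightarrow> ?s (x i) \<le> ?s y"
    proof (intro allI impI)
      fix t assume "\<bar>x i - t\<bar> < x i"
      then have "\<forall>v\<in>V. 0 \<le> (x(i := t)) v" using x0 by auto
      then have "form E (x(i := t)) \<le> R * knorm V (x(i := t))"
        using R unfolding form_bound_def by blast
      then show "?s (x i) \<le> ?s t" using eq by simp
    qed
  qed
  show "(?s has_real_derivative 0) (at (x i))"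
    using der unfolding \<open>?D = 0\<close> .
  show "(R - \<alpha> * real (hg_degree E i)) * x i ^ (k - 1) = (1 - \<alpha>) * link_sum E i x"
    using \<open>?D = 0\<close> k0 by simp
qed

text \<open>Criticality at the positive \<open>x\<close> makes \<open>R\<close> itself an
  eigenvalue. For any other eigenvalue, pass to the moduli \<open>y\<close> of an eigenvector: the
  triangle inequality, multiplication by \<open>y i\<close> and summation over \<open>i\<close>
  bring it under \<open>form E y\<close>, hence under \<open>R * knorm V y\<close>.\<close>

lemma rho_alpha_eqI:
  assumes G: "k_uniform_hypergraph k V E" and ne: "V \<noteq> {}" and R: "form_bound V E R"
    and xp: "\<And>v. v \<in> V \<Longrightarrow> 0 < x v" and eq: "form E x = R * knorm V x"
  shows "rho_alpha k \<alpha> V E = R"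
proof -
  have finV: "finite V" and k0: "k > 0"
    using G k2 unfolding k_uniform_hypergraph_def by auto
  have kn: "knorm V x > 0" using knorm_pos finV ne xp by blast
  have form0: "form E x \<ge> 0" unfolding form_def edge_form_def
    using \<alpha>0 \<alpha>1 G
    by (intro sum_nonneg add_nonneg_nonneg mult_nonneg_nonneg prod_nonneg sum_nonneg zero_le_power)
      (auto simp: k_uniform_hypergraph_def subset_iff xp less_imp_le)
  then have R0: "R \<ge> 0" using kn eq by (simp add: zero_le_mult_iff)
  have "tensor_eigenvalue k V (A_alpha_tensor k \<alpha> E) (of_real R)"
    unfolding tensor_eigenvalue_def
  proof (intro exI[of _ "\<lambda>v. complex_of_real (x v)"] conjI ballI)
    show "\<exists>i\<in>V. complex_of_real (x i) \<noteq> 0" using ne xp by fastforce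
    fix i assume i: "i \<in> V"
    have "(R - \<alpha> * real (hg_degree E i)) * x i ^ (k - 1) = (1 - \<alpha>) * link_sum E i x"
      using maximizer_critical(1)[OF G R _ eq i xp[OF i]] xp by (simp add: less_imp_le)
    then have "\<alpha> * real (hg_degree E i) * x i ^ (k - 1) + (1 - \<alpha>) * link_sum E i x = R * x i ^ (k - 1)"
      by (simp add: algebra_simps)
    moreover have "link_sum E i (\<lambda>v. complex_of_real (x v)) = of_real (link_sum E i x)"
      unfolding link_sum_def by simp
    ultimately show "tensor_apply k V (A_alpha_tensor k \<alpha> E) (\<lambda>v. complex_of_real (x v)) i
        = complex_of_real R * complex_of_real (x i) ^ (k - 1)"
      unfolding tensor_apply_A_alpha[OF G k2 i]
      by (simp del: of_real_diff flip: of_real_mult of_real_add of_real_power)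
  qed
  then have mem: "R \<in> {cmod \<mu> | \<mu>. tensor_eigenvalue k V (A_alpha_tensor k \<alpha> E) \<mu>}"
    using R0 by (auto intro!: exI[of _ "complex_of_real R"])
  have le: "cmod \<mu> \<le> R" if ev: "tensor_eigenvalue k V (A_alpha_tensor k \<alpha> E) \<mu>" for \<mu>
  proof -
    from ev obtain z where z: "\<exists>i\<in>V. z i \<noteq> 0"
      "\<And>i. i \<in> V \<Longrightarrow> tensor_apply k V (A_alpha_tensor k \<alpha> E) z i = \<mu> * z i ^ (k - 1)"
      unfolding tensor_eigenvalue_def by auto
    define y where "y v = cmod (z v)" for v
    have link: "cmod (link_sum E i z) \<le> link_sum E i y" for i
      unfolding link_sum_def y_def
      by (rule order_trans[OF norm_sum]) (simp add: prod_norm)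
    have "cmod \<mu> * y i ^ k \<le> \<alpha> * real (hg_degree E i) * y i ^ k + (1 - \<alpha>) * (y i * link_sum E i y)"
      if i: "i \<in> V" for i
    proof -
      have "cmod \<mu> * y i ^ (k - 1) = cmod (\<mu> * z i ^ (k - 1))"
        by (simp add: y_def norm_mult norm_power)
      also have "\<dots> = cmod (of_real (\<alpha> * real (hg_degree E i)) * z i ^ (k - 1)
          + of_real (1 - \<alpha>) * link_sum E i z)"
        using z(2)[OF i] tensor_apply_A_alpha[OF G k2 i] by simp
      also have "\<dots> \<le> \<alpha> * real (hg_degree E i) * y i ^ (k - 1) + (1 - \<alpha>) * cmod (link_sum E i z)"
        by (rule order_trans[OF norm_triangle_ineq])
          (use \<alpha>0 \<alpha>1 in \<open>simp add: norm_mult norm_power y_def del: of_real_diff of_real_mult\<close>)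
      also have "\<dots> \<le> \<alpha> * real (hg_degree E i) * y i ^ (k - 1) + (1 - \<alpha>) * link_sum E i y"
        using \<alpha>1 link by (intro add_left_mono mult_left_mono) auto
      finally have "y i * (cmod \<mu> * y i ^ (k - 1))
          \<le> y i * (\<alpha> * real (hg_degree E i) * y i ^ (k - 1) + (1 - \<alpha>) * link_sum E i y)"
        by (intro mult_left_mono) (auto simp: y_def)
      moreover have "y i ^ k = y i * y i ^ (k - 1)" using k0 by (simp add: power_eq_if)
      ultimately show ?thesis by (simp add: algebra_simps)
    qed
    then have "cmod \<mu> * knorm V y \<le> form E y"
      unfolding form_eq_link_sum[OF G] knorm_def sum_distrib_left by (rule sum_mono)
    also have "\<dots> \<le> R * knorm V y" using R unfolding form_bound_def by (simp add: y_def)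
    finally have "cmod \<mu> * knorm V y \<le> R * knorm V y" .
    moreover have "knorm V y > 0"
      using z(1) finV unfolding knorm_def y_def by (auto intro!: sum_pos2)
    ultimately show ?thesis by simp
  qed
  show ?thesis unfolding rho_alpha_def using mem le by (intro cSup_eq_maximum) auto
qed

lemma perron:
  assumes G: "k_uniform_hypergraph k V E" and "hg_connected V E" "V \<noteq> {}"
  obtains x where "\<And>v. 0 < x v" "form E x = rho_alpha k \<alpha> V E * knorm V x"
    "form_bound V E (rho_alpha k \<alpha> V E)"
proof -
  obtain R x where Rx: "form_bound V E R" "\<And>v. 0 \<le> x v" "knorm V x = 1" "form E x = R"
    using ex_form_maximizer[OF assms(1,3)] by metis
  have xp: "0 < x v" if "v \<in> V" for v
    using maximizer_pos[OF assms(1,2) Rx that] .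
  have rho: "rho_alpha k \<alpha> V E = R"
    by (rule rho_alpha_eqI[OF assms(1,3) Rx(1) xp]) (use Rx in auto)
  \<comment> \<open>Neither \<open>form\<close> nor \<open>knorm\<close> sees values off
    \<open>V\<close>; the value 1 makes the vector positive on the whole type, so that line data
    read from it are positive at every index.\<close>
  define y where "y v = (if v \<in> V then x v else 1)" for v
  have "form E y = form E x" "knorm V y = knorm V x"
    by (auto intro!: form_cong[OF G] knorm_cong simp: y_def)
  then show ?thesis by (intro that[of y]) (use xp Rx rho in \<open>auto simp: y_def\<close>)
qed

end

subsection \<open>Pendant paths\<close>

definition path_vertex :: "'b \<Rightarrow> nat \<Rightarrow> 'b + nat \<times> nat" where
  "path_vertex u i = (if i = 0 then Inl u else Inr (i, 1))"

lemma path_edge_eq: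
  assumes "i \<ge> 1"
  shows "path_edge k u i = insert (path_vertex u (i - 1)) ((\<lambda>j. Inr (i, j)) ` {1..k-1})"
  using assms unfolding path_edge_def path_vertex_def by auto

lemma path_vertex_notin:
  assumes "i \<ge> 1"
  shows "path_vertex u (i - 1) \<notin> (\<lambda>j. Inr (i, j)) ` {1..k-1}"
  using assms unfolding path_vertex_def by auto

lemma attach_path_V_eq:
  "attach_path_V k V s = Inl ` V \<union> (\<lambda>(i, j). Inr (i, j)) ` ({1..s} \<times> {1..k-1})"
  unfolding attach_path_V_def by auto

lemma attach_path_E_eq:
  "attach_path_E k E u s = (`) Inl ` E \<union> path_edge k u ` {1..s}"
  unfolding attach_path_E_def by auto

lemma attach_path_uniform:
  assumes "k_uniform_hypergraph k V E" "u \<in> V" "k \<ge> 2"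
  shows "k_uniform_hypergraph k (attach_path_V k V s) (attach_path_E k E u s)"
  unfolding k_uniform_hypergraph_def
proof (intro conjI ballI)
  show "finite (attach_path_V k V s)"
    using assms unfolding attach_path_V_eq k_uniform_hypergraph_def by auto
  fix e assume "e \<in> attach_path_E k E u s"
  then consider (old) e' where "e' \<in> E" "e = Inl ` e'" | (new) i where "i \<in> {1..s}" "e = path_edge k u i"
    unfolding attach_path_E_eq by auto
  then have "e \<subseteq> attach_path_V k V s \<and> card e = k"
  proof cases
    case old
    then show ?thesis using assms unfolding k_uniform_hypergraph_def attach_path_V_eq
      by (auto simp: card_image)
  next
    case new
    have i: "i \<ge> 1" using new by simp
    have "card e = Suc (card ((\<lambda>j. Inr (i, j) :: 'a + nat \<times> nat) ` {1..k-1}))"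
      unfolding new path_edge_eq[OF i] using path_vertex_notin[OF i, of u k]
      by (intro card_insert_disjoint) auto
    also have "card ((\<lambda>j. Inr (i, j) :: 'a + nat \<times> nat) ` {1..k-1}) = k - 1"
      by (subst card_image) (auto simp: inj_on_def)
    finally have "card e = k" using assms by simp
    moreover have "e \<subseteq> attach_path_V k V s"
      using new assms unfolding path_edge_def attach_path_V_def by auto
    ultimately show ?thesis by simp
  qed
  then show "e \<subseteq> attach_path_V k V s" "card e = k" by auto
qed

lemma hg_adj_sym: "sym (hg_adj E)"
  unfolding hg_adj_def sym_def by auto

lemma hg_connectedI_root:
  assumes "\<And>v. v \<in> V \<Longrightarrow> (r, v) \<in> (hg_adj E)\<^sup>*"
  shows "hg_connected V E"
  unfolding hg_connected_def
  using assms by (meson hg_adj_sym rtrancl_trans symD sym_rtrancl)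

lemma attach_path_connected:
  assumes "hg_connected V E" "u \<in> V" "k \<ge> 2"
  shows "hg_connected (attach_path_V k V s) (attach_path_E k E u s)"
proof (rule hg_connectedI_root)
  let ?A = "hg_adj (attach_path_E k E u s)"
  have old: "(Inl u, Inl v) \<in> ?A\<^sup>*" if "(u, v) \<in> (hg_adj E)\<^sup>*" for v
    using that
  proof (induction rule: rtrancl_induct)
    case (step y z)
    then have "(Inl y, Inl z) \<in> ?A" unfolding hg_adj_def attach_path_E_eq by auto
    then show ?case using step by (meson rtrancl.rtrancl_into_rtrancl)
  qed simp
  have edge: "(path_vertex u (i - 1), Inr (i, j)) \<in> ?A"
    if "1 \<le> i" "i \<le> s" "1 \<le> j" "j \<le> k - 1" for i j
  proof -
    have "path_edge k u i \<in> attach_path_E k E u s" using that unfolding attach_path_E_eq by auto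
    then show ?thesis unfolding hg_adj_def using that
      by (auto simp: path_edge_eq intro!: bexI[of _ "path_edge k u i"])
  qed
  have path: "(Inl u, path_vertex u i) \<in> ?A\<^sup>*" if "i \<le> s" for i
    using that
  proof (induction i)
    case (Suc i)
    then have "(path_vertex u i, path_vertex u (Suc i)) \<in> ?A"
      using edge[of "Suc i" 1] assms(3) by (auto simp: path_vertex_def)
    then show ?case using Suc by (meson Suc_leD rtrancl.rtrancl_into_rtrancl)
  qed (simp add: path_vertex_def)
  fix v assume "v \<in> attach_path_V k V s"
  then consider (o) w where "w \<in> V" "v = Inl w"
    | (n) i j where "v = Inr (i, j)" "1 \<le> i" "i \<le> s" "1 \<le> j" "j \<le> k - 1"
    unfolding attach_path_V_eq by auto
  then show "(Inl u, v) \<in> ?A\<^sup>*"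
  proof cases
    case o
    then show ?thesis using assms old unfolding hg_connected_def by auto
  next
    case n
    then have "i - 1 \<le> s" by simp
    from rtrancl.rtrancl_into_rtrancl[OF path[OF this] edge[OF n(2-5)]] show ?thesis
      using n(1) by simp
  qed
qed

lemma split_at_one:
  assumes "k \<ge> (2::nat)"
  shows "{1..k-1} = insert 1 {2..k-1}"
  using assms by auto

section \<open>Form and norm of a hypergraph with one pendant path\<close>

context alpha_form
begin

text \<open>The interior starts at index 2 because \<open>Inr (i, 1)\<close> is the end vertex
  \<open>w_i\<close>. Keeping the ends apart from the interior makes the symmetry in
  \<open>a\<close> and \<open>b\<close> available, which every reversal uses; for
  \<open>k = 2\<close> the interior is empty.\<close>

definition path_term :: "real \<Rightarrow> real \<Rightarrow> (nat \<Rightarrow> real) \<Rightarrow> real" where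
  "path_term a b z = \<alpha> * (a ^ k + b ^ k + (\<Sum>j=2..k-1. z j ^ k))
    + (1 - \<alpha>) * real k * (a * b * (\<Prod>j=2..k-1. z j))"

lemma edge_form_path_edge:
  assumes "i \<ge> 1"
  shows "edge_form x (path_edge k u i) =
    path_term (x (path_vertex u (i - 1))) (x (path_vertex u i)) (\<lambda>j. x (Inr (i, j)))"
proof -
  have v: "path_vertex u i = Inr (i, 1)" using assms by (simp add: path_vertex_def)
  have inj: "inj_on (\<lambda>j. Inr (i, j) :: 'a + nat \<times> nat) {1..k-1}" by (auto simp: inj_on_def)
  have "(\<Sum>v\<in>path_edge k u i. x v ^ k) = x (path_vertex u (i - 1)) ^ k + (\<Sum>j\<in>{1..k-1}. x (Inr (i, j)) ^ k)"
    unfolding path_edge_eq[OF assms] using path_vertex_notin[OF assms, of u k] inj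
    by (subst sum.insert) (auto simp: sum.reindex)
  moreover have "(\<Prod>v\<in>path_edge k u i. x v) = x (path_vertex u (i - 1)) * (\<Prod>j\<in>{1..k-1}. x (Inr (i, j)))"
    unfolding path_edge_eq[OF assms] using path_vertex_notin[OF assms, of u k] inj
    by (subst prod.insert) (auto simp: prod.reindex)
  ultimately show ?thesis
    unfolding edge_form_def path_term_def v split_at_one[OF k2] by (simp add: mult_ac)
qed

lemma form_attach_path:
  assumes G: "k_uniform_hypergraph k V E"
  shows "form (attach_path_E k E u s) x = form E (\<lambda>v. x (Inl v)) +
    (\<Sum>i=1..s. path_term (x (path_vertex u (i - 1))) (x (path_vertex u i)) (\<lambda>j. x (Inr (i, j))))"
proof -
  have inr: "Inr (i, 1) \<in> path_edge k u i" if "i \<ge> 1" for i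
    using that k2 unfolding path_edge_eq[OF that] by auto
  have disj: "((`) Inl ` E) \<inter> path_edge k u ` {1..s} = {}"
    using inr by fastforce
  have inj: "inj_on (path_edge k u) {1..s}"
  proof (rule inj_onI)
    fix i j assume ij: "i \<in> {1..s}" "j \<in> {1..s}" "path_edge k u i = path_edge k u j"
    \<comment> \<open>The vertex \<open>w_i\<close> lies only in the path edges \<open>f_i\<close>
      and \<open>f_(i+1)\<close>, so the two memberships together force
      \<open>i = j\<close>.\<close>
    then have "Inr (i, 1) \<in> path_edge k u j" "Inr (j, 1) \<in> path_edge k u i"
      using inr[of i] inr[of j] by auto
    then show "i = j" using ij unfolding path_edge_def by (auto split: if_splits)
  qed
  have "form (attach_path_E k E u s) x =
      (\<Sum>e\<in>(`) Inl ` E. edge_form x e) + (\<Sum>e\<in>path_edge k u ` {1..s}. edge_form x e)"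
    unfolding form_def attach_path_E_eq using finite_edges[OF G] disj
    by (intro sum.union_disjoint) auto
  also have "(\<Sum>e\<in>(`) Inl ` E. edge_form x e) = (\<Sum>e\<in>E. edge_form x (Inl ` e))"
    by (subst sum.reindex) (auto simp: inj_image_eq_iff intro!: inj_onI)
  also have "\<dots> = form E (\<lambda>v. x (Inl v))"
    unfolding form_def edge_form_def by (simp add: sum.reindex prod.reindex)
  also have "(\<Sum>e\<in>path_edge k u ` {1..s}. edge_form x e) =
      (\<Sum>i=1..s. path_term (x (path_vertex u (i - 1))) (x (path_vertex u i)) (\<lambda>j. x (Inr (i, j))))"
    unfolding sum.reindex[OF inj] o_def by (intro sum.cong refl edge_form_path_edge) auto
  finally show ?thesis .
qed

lemma knorm_attach_path:
  assumes "finite V"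
  shows "knorm (attach_path_V k V s) x = knorm V (\<lambda>v. x (Inl v)) +
    (\<Sum>i=1..s. x (path_vertex u i) ^ k + (\<Sum>j=2..k-1. x (Inr (i, j)) ^ k))"
proof -
  have "knorm (attach_path_V k V s) x =
     (\<Sum>v\<in>Inl ` V. x v ^ k) + (\<Sum>v\<in>(\<lambda>(i, j). Inr (i, j)) ` ({1..s} \<times> {1..k-1}). x v ^ k)"
    unfolding knorm_def attach_path_V_eq using assms by (intro sum.union_disjoint) auto
  also have "(\<Sum>v\<in>Inl ` V. x v ^ k) = knorm V (\<lambda>v. x (Inl v))"
    by (simp add: sum.reindex knorm_def)
  also have "(\<Sum>v\<in>(\<lambda>(i, j). Inr (i, j)) ` ({1..s} \<times> {1..k-1}). x v ^ k)
      = (\<Sum>i=1..s. \<Sum>j\<in>{1..k-1}. x (Inr (i, j)) ^ k)"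
    by (subst sum.reindex) (auto simp: inj_on_def sum.cartesian_product case_prod_unfold)
  also have "\<dots> = (\<Sum>i=1..s. x (path_vertex u i) ^ k + (\<Sum>j=2..k-1. x (Inr (i, j)) ^ k))"
    unfolding split_at_one[OF k2] by (intro sum.cong refl) (auto simp: path_vertex_def)
  finally show ?thesis .
qed

text \<open>Data on a hypergraph glued to a path: \<open>g\<close> on the hypergraph, \<open>c l\<close> on the path vertices, and
  \<open>Z l j\<close> with \<open>2 \<le> j \<le> k - 1\<close> on the interior of the edge between \<open>c (l - 1)\<close> and \<open>c l\<close>.  The root
  value \<open>g u\<close> reappears among the \<open>c l\<close>, so the norm leaves \<open>u\<close> out of \<open>V\<close>.\<close>

definition line_form :: "'b set set \<Rightarrow> nat \<Rightarrow> ('b \<Rightarrow> real) \<Rightarrow> (nat \<Rightarrow> real) \<Rightarrow> (nat \<Rightarrow> nat \<Rightarrow> real) \<Rightarrow> real" where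
  "line_form E N g c Z = form E g + (\<Sum>l=1..N. path_term (c (l - 1)) (c l) (Z l))"

definition line_norm :: "'b set \<Rightarrow> 'b \<Rightarrow> nat \<Rightarrow> ('b \<Rightarrow> real) \<Rightarrow> (nat \<Rightarrow> real) \<Rightarrow> (nat \<Rightarrow> nat \<Rightarrow> real) \<Rightarrow> real" where
  "line_norm V u N g c Z = knorm (V - {u}) g + (\<Sum>l\<le>N. c l ^ k) + (\<Sum>l=1..N. \<Sum>j=2..k-1. Z l j ^ k)"

lemma path_term_cong:
  assumes "\<And>j. j \<in> {2..k-1} \<Longrightarrow> z j = z' j"
  shows "path_term a b z = path_term a b z'"
proof -
  have "(\<Prod>j=2..k-1. z j) = (\<Prod>j=2..k-1. z' j)" by (intro prod.cong refl assms)
  then show ?thesis unfolding path_term_def using assms by simp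
qed

lemma line_form_cong:
  assumes "\<And>l j. j \<in> {2..k-1} \<Longrightarrow> Z l j = Z' l j"
  shows "line_form E N g c Z = line_form E N g c Z'"
  unfolding line_form_def
  by (intro arg_cong[where f = "(+) (form E g)"] sum.cong refl path_term_cong assms)

lemma line_norm_cong:
  assumes "\<And>l j. j \<in> {2..k-1} \<Longrightarrow> Z l j = Z' l j"
  shows "line_norm V u N g c Z = line_norm V u N g c Z'"
  unfolding line_norm_def using assms by simp

end

text \<open>The two pendant paths of \<open>G_u(s,t)\<close> as one path: positions \<open>0, \<dots>, t\<close> run from the free end of the
  second path to \<open>u\<close>, positions \<open>t, \<dots>, s + t\<close> from \<open>u\<close> along the first.\<close>

definition line_vertex :: "'b \<Rightarrow> nat \<Rightarrow> nat \<Rightarrow> ('b + nat \<times> nat) + nat \<times> nat" where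
  "line_vertex u t l = (if l \<le> t then path_vertex (Inl u) (t - l) else Inl (path_vertex u (l - t)))"

text \<open>Edge \<open>l\<close> of the line joins positions \<open>l - 1\<close> and
  \<open>l\<close>. For \<open>1 \<le> l \<le> t\<close> these are \<open>w_(t+1-l)\<close> and
  \<open>w_(t-l)\<close> of the second path, so the edge is its \<open>f_(t+1-l)\<close>; hence the
  offset differs by one from that of the vertices.\<close>

definition line_inner :: "nat \<Rightarrow> nat \<Rightarrow> nat \<Rightarrow> ('b + nat \<times> nat) + nat \<times> nat" where
  "line_inner t l j = (if l \<le> t then Inr (t + 1 - l, j) else Inl (Inr (l - t, j)))"

lemma line_vertex_left: "i \<le> t \<Longrightarrow> line_vertex u t (t - i) = path_vertex (Inl u) i"
  by (simp add: line_vertex_def)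

lemma line_inner_left: "1 \<le> i \<Longrightarrow> i \<le> t \<Longrightarrow> line_inner t (t + 1 - i) j = Inr (i, j)"
  by (auto simp: line_inner_def)

lemma line_vertex_inj: "inj (line_vertex u t)"
  by (auto simp: inj_on_def line_vertex_def path_vertex_def split: if_splits)

lemma sum_split_line:
  fixes f :: "nat \<Rightarrow> 'c::comm_monoid_add"
  shows "(\<Sum>l=1..s+t. f l) = (\<Sum>i=1..s. f (t + i)) + (\<Sum>i=1..t. f (t + 1 - i))"
proof -
  have "(\<Sum>l=1..s+t. f l) = (\<Sum>l=1..t. f l) + (\<Sum>l=t+1..t+s. f l)"
    using sum.ub_add_nat[of 1 t f s] by (simp add: add.commute)
  also have "(\<Sum>l=t+1..t+s. f l) = (\<Sum>i=1..s. f (t + i))"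
    by (rule sum.reindex_bij_witness[of _ "\<lambda>i. t + i" "\<lambda>l. l - t"]) auto
  also have "(\<Sum>l=1..t. f l) = (\<Sum>i=1..t. f (t + 1 - i))"
    by (rule sum.reindex_bij_witness[of _ "\<lambda>i. t + 1 - i" "\<lambda>i. t + 1 - i"]) auto
  finally show ?thesis by (simp add: add.commute)
qed

lemma Gpq_uniform:
  assumes "k_uniform_hypergraph k V E" "u \<in> V" "k \<ge> 2"
  shows "k_uniform_hypergraph k (Gpq_V k V s t) (Gpq_E k E u s t)"
  unfolding Gpq_V_def Gpq_E_def using assms
  by (intro attach_path_uniform) (auto simp: attach_path_V_def)

lemma Gpq_connected:
  assumes "hg_connected V E" "u \<in> V" "k \<ge> 2"
  shows "hg_connected (Gpq_V k V s t) (Gpq_E k E u s t)"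
  unfolding Gpq_V_def Gpq_E_def using assms
  by (intro attach_path_connected) (auto simp: attach_path_V_def)

lemma line_vertex_in:
  assumes "u \<in> V" "k \<ge> 2" "l \<le> s + t"
  shows "line_vertex u t l \<in> Gpq_V k V s t"
  using assms unfolding line_vertex_def path_vertex_def Gpq_V_def attach_path_V_def
  by (auto intro!: imageI)

context alpha_form
begin

section \<open>Line coordinates for both pendant paths\<close>

lemma path_term_commute: "path_term a b z = path_term b a z"
  unfolding path_term_def by (simp add: mult_ac add_ac)

text \<open>The second path is traversed from its free end, so each of its edges appears with its
  ends exchanged; \<open>path_term_commute\<close> absorbs this.\<close>

lemma form_Gpq:
  assumes G: "k_uniform_hypergraph k V E" and u: "u \<in> V"
  shows "form (Gpq_E k E u s t) x = line_form E (s + t) (\<lambda>v. x (Inl (Inl v)))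
    (\<lambda>l. x (line_vertex u t l)) (\<lambda>l j. x (line_inner t l j))"
proof -
  let ?f = "\<lambda>l. path_term (x (line_vertex u t (l - 1))) (x (line_vertex u t l)) (\<lambda>j. x (line_inner t l j))"
  have "form (Gpq_E k E u s t) x = form E (\<lambda>v. x (Inl (Inl v)))
     + (\<Sum>i=1..s. path_term (x (Inl (path_vertex u (i - 1)))) (x (Inl (path_vertex u i))) (\<lambda>j. x (Inl (Inr (i, j)))))
     + (\<Sum>i=1..t. path_term (x (path_vertex (Inl u) (i - 1))) (x (path_vertex (Inl u) i)) (\<lambda>j. x (Inr (i, j))))"
    unfolding Gpq_E_def form_attach_path[OF attach_path_uniform[OF G u k2]] form_attach_path[OF G] by simp
  also have "(\<Sum>i=1..s. path_term (x (Inl (path_vertex u (i - 1)))) (x (Inl (path_vertex u i))) (\<lambda>j. x (Inl (Inr (i, j)))))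
      = (\<Sum>i=1..s. ?f (t + i))"
    by (intro sum.cong refl) (auto simp: line_vertex_def line_inner_def path_vertex_def)
  also have "(\<Sum>i=1..t. path_term (x (path_vertex (Inl u) (i - 1))) (x (path_vertex (Inl u) i)) (\<lambda>j. x (Inr (i, j))))
      = (\<Sum>i=1..t. ?f (t + 1 - i))"
  proof (intro sum.cong refl)
    fix i assume i: "i \<in> {1..t}"
    have "line_vertex u t (t + 1 - i - 1) = path_vertex (Inl u) i"
      using i line_vertex_left[of i t u] by simp
    moreover have "line_vertex u t (t + 1 - i) = path_vertex (Inl u) (i - 1)"
      using i line_vertex_left[of "i - 1" t u] by auto
    ultimately have "?f (t + 1 - i) = path_term (x (path_vertex (Inl u) i)) (x (path_vertex (Inl u) (i - 1))) (\<lambda>j. x (Inr (i, j)))"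
      using i by (simp only: line_inner_left atLeastAtMost_iff)
    then show "path_term (x (path_vertex (Inl u) (i - 1))) (x (path_vertex (Inl u) i)) (\<lambda>j. x (Inr (i, j)))
      = ?f (t + 1 - i)" by (simp add: path_term_commute)
  qed
  finally show ?thesis unfolding line_form_def sum_split_line[of ?f s t] by (simp add: add.assoc)
qed

lemma knorm_Gpq:
  assumes G: "k_uniform_hypergraph k V E" and u: "u \<in> V"
  shows "knorm (Gpq_V k V s t) x = line_norm V u (s + t) (\<lambda>v. x (Inl (Inl v)))
    (\<lambda>l. x (line_vertex u t l)) (\<lambda>l j. x (line_inner t l j))"
proof -
  have finV: "finite V" using G unfolding k_uniform_hypergraph_def by auto
  have finA: "finite (attach_path_V k V s)"
    using attach_path_uniform[OF G u k2] unfolding k_uniform_hypergraph_def by blast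
  let ?c = "\<lambda>l. x (line_vertex u t l) ^ k"
  let ?z = "\<lambda>l. \<Sum>j=2..k-1. x (line_inner t l j) ^ k"
  have "knorm (Gpq_V k V s t) x = knorm V (\<lambda>v. x (Inl (Inl v)))
     + (\<Sum>i=1..s. x (Inl (path_vertex u i)) ^ k + (\<Sum>j=2..k-1. x (Inl (Inr (i, j))) ^ k))
     + (\<Sum>i=1..t. x (path_vertex (Inl u) i) ^ k + (\<Sum>j=2..k-1. x (Inr (i, j)) ^ k))"
    unfolding Gpq_V_def knorm_attach_path[OF finA, of t x "Inl u"] knorm_attach_path[OF finV, of s _ u] by simp
  also have "(\<Sum>i=1..s. x (Inl (path_vertex u i)) ^ k + (\<Sum>j=2..k-1. x (Inl (Inr (i, j))) ^ k))
     = (\<Sum>i=1..s. ?c (t + i)) + (\<Sum>i=1..s. ?z (t + i))"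
    unfolding sum.distrib[symmetric]
    by (intro sum.cong refl) (auto simp: line_vertex_def line_inner_def path_vertex_def)
  also have "(\<Sum>i=1..t. x (path_vertex (Inl u) i) ^ k + (\<Sum>j=2..k-1. x (Inr (i, j)) ^ k))
     = (\<Sum>i=1..t. ?c (t - i)) + (\<Sum>i=1..t. ?z (t + 1 - i))"
    unfolding sum.distrib[symmetric]
    by (intro sum.cong refl) (simp only: line_vertex_left line_inner_left atLeastAtMost_iff)
  also have "(\<Sum>i=1..t. ?c (t - i)) = (\<Sum>l<t. ?c l)"
    by (rule sum.reindex_bij_witness[of _ "\<lambda>i. t - i" "\<lambda>i. t - i"]) auto
  \<comment> \<open>The root is taken out of \<open>V\<close> and counted as position
    \<open>t\<close> of the line, so that it is not counted twice.\<close>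
  also have "knorm V (\<lambda>v. x (Inl (Inl v))) = knorm (V - {u}) (\<lambda>v. x (Inl (Inl v))) + ?c t"
    unfolding knorm_def sum.remove[OF finV u] by (simp add: line_vertex_def path_vertex_def)
  finally have 1: "knorm (Gpq_V k V s t) x = knorm (V - {u}) (\<lambda>v. x (Inl (Inl v)))
     + ((\<Sum>l<t. ?c l) + ?c t + (\<Sum>i=1..s. ?c (t + i))) + ((\<Sum>i=1..s. ?z (t + i)) + (\<Sum>i=1..t. ?z (t + 1 - i)))"
    by simp
  have "(\<Sum>l<t. ?c l) + ?c t + (\<Sum>i=1..s. ?c (t + i)) = (\<Sum>l\<le>s + t. ?c l)"
  proof (induction s)
    case 0
    then show ?case by (simp add: lessThan_Suc_atMost[symmetric])
  next
    case (Suc s)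
    then show ?case by (simp add: add.commute)
  qed
  then show ?thesis unfolding 1 line_norm_def sum_split_line[of ?z s t] by simp
qed

text \<open>Line data assemble into a vector on \<open>G_u(s,t)\<close>; the only overlap is the
  root, whence the condition \<open>g u = c t\<close>.\<close>

lemma line_bound:
  assumes G: "k_uniform_hypergraph k V E" and conn: "hg_connected V E" and u: "u \<in> V"
    and nonneg: "\<And>v. 0 \<le> g v" "\<And>l. 0 \<le> c l" "\<And>l j. 0 \<le> Z l j" and gu: "g u = c t"
  shows "line_form E (s + t) g c Z \<le> rho_alpha k \<alpha> (Gpq_V k V s t) (Gpq_E k E u s t) * line_norm V u (s + t) g c Z"
proof -
  define y where "y = (\<lambda>v. case v of
      Inl (Inl w) \<Rightarrow> g w
    | Inl (Inr (i, j)) \<Rightarrow> if j = 1 then c (t + i) else Z (t + i) j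
    | Inr (i, j) \<Rightarrow> if j = 1 then c (t - i) else Z (t + 1 - i) j)"
  have y1: "y (Inl (Inl v)) = g v" for v by (simp add: y_def)
  have y2: "y (line_vertex u t l) = c l" for l
    using gu by (auto simp: y_def line_vertex_def path_vertex_def)
  have y3: "y (line_inner t l j) = Z l j" if "j \<in> {2..k-1}" for l j
    using that by (auto simp: y_def line_inner_def)
  have y0: "0 \<le> y v" for v
    using nonneg by (auto simp: y_def split: sum.splits)
  have "Gpq_V k V s t \<noteq> {}" using u unfolding Gpq_V_def attach_path_V_def by auto
  from perron[OF Gpq_uniform[OF G u k2] Gpq_connected[OF conn u k2] this]
  have "form_bound (Gpq_V k V s t) (Gpq_E k E u s t) (rho_alpha k \<alpha> (Gpq_V k V s t) (Gpq_E k E u s t))"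
    by metis
  then have "form (Gpq_E k E u s t) y \<le> rho_alpha k \<alpha> (Gpq_V k V s t) (Gpq_E k E u s t) * knorm (Gpq_V k V s t) y"
    using y0 unfolding form_bound_def by auto
  moreover have "form (Gpq_E k E u s t) y = line_form E (s + t) g c Z"
    unfolding form_Gpq[OF G u] y1 y2 by (intro line_form_cong y3)
  moreover have "knorm (Gpq_V k V s t) y = line_norm V u (s + t) g c Z"
    unfolding knorm_Gpq[OF G u] y1 y2 by (intro line_norm_cong y3)
  ultimately show ?thesis by simp
qed

lemma line_form_reflect:
  "line_form E N g (\<lambda>l. c (N - l)) (\<lambda>l. Z (N + 1 - l)) = line_form E N g c Z"
proof -
  have "(\<Sum>l=1..N. path_term (c (N - (l - 1))) (c (N - l)) (Z (N + 1 - l)))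
      = (\<Sum>l=1..N. path_term (c (l - 1)) (c l) (Z l))"
    by (rule sum.reindex_bij_witness[of _ "\<lambda>l. N + 1 - l" "\<lambda>l. N + 1 - l"])
      (auto simp: path_term_commute Suc_diff_le)
  then show ?thesis unfolding line_form_def by simp
qed

lemma line_norm_reflect:
  "line_norm V u N g (\<lambda>l. c (N - l)) (\<lambda>l. Z (N + 1 - l)) = line_norm V u N g c Z"
proof -
  have "(\<Sum>l\<le>N. c (N - l) ^ k) = (\<Sum>l\<le>N. c l ^ k)"
    by (rule sum.reindex_bij_witness[of _ "\<lambda>l. N - l" "\<lambda>l. N - l"]) auto
  moreover have "(\<Sum>l=1..N. \<Sum>j=2..k-1. Z (N + 1 - l) j ^ k) = (\<Sum>l=1..N. \<Sum>j=2..k-1. Z l j ^ k)"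
    by (rule sum.reindex_bij_witness[of _ "\<lambda>l. N + 1 - l" "\<lambda>l. N + 1 - l"]) auto
  ultimately show ?thesis unfolding line_norm_def by simp
qed

text \<open>On its own line \<open>G_u(p,q)\<close> has its root at position \<open>q\<close>. The
  surgeries work on the line of \<open>G_u(p+1,q-1)\<close> and put the root at position
  \<open>p\<close>, which is the same hypergraph read from the other end.\<close>

lemma line_bound_reflect:
  assumes G: "k_uniform_hypergraph k V E" and conn: "hg_connected V E" and u: "u \<in> V"
    and nonneg: "\<And>v. 0 \<le> g v" "\<And>l. 0 \<le> c l" "\<And>l j. 0 \<le> Z l j" and gu: "g u = c s"
  shows "line_form E (s + t) g c Z \<le> rho_alpha k \<alpha> (Gpq_V k V s t) (Gpq_E k E u s t) * line_norm V u (s + t) g c Z"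
  using line_bound[OF G conn u, of g "\<lambda>l. c (s + t - l)" "\<lambda>l. Z (s + t + 1 - l)" t s] nonneg gu
  unfolding line_form_reflect line_norm_reflect by simp

text \<open>The root value is stored both as \<open>g u\<close> and as \<open>c t\<close>, so a
  variation at position \<open>t\<close> has to change both copies.\<close>

lemma line_perron:
  fixes s t :: nat
  assumes G: "k_uniform_hypergraph k V E" and conn: "hg_connected V E" and u: "u \<in> V"
  defines "R \<equiv> rho_alpha k \<alpha> (Gpq_V k V s t) (Gpq_E k E u s t)"
  obtains g c Z where "\<And>v. 0 < g v" "\<And>l. 0 < c l" "\<And>l j. 0 < Z l j" "g u = c t"
    "line_form E (s + t) g c Z = R * line_norm V u (s + t) g c Z"
    "\<And>l. l \<le> s + t \<Longrightarrow> ((\<lambda>r. R * line_norm V u (s + t) (if l = t then g(u := r) else g) (c(l := r)) Z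
        - line_form E (s + t) (if l = t then g(u := r) else g) (c(l := r)) Z) has_real_derivative 0) (at (c l))"
proof -
  have ne: "Gpq_V k V s t \<noteq> {}" using u unfolding Gpq_V_def attach_path_V_def by auto
  obtain x where x: "\<And>v. 0 < x v" "form (Gpq_E k E u s t) x = R * knorm (Gpq_V k V s t) x"
    "form_bound (Gpq_V k V s t) (Gpq_E k E u s t) R"
    using perron[OF Gpq_uniform[OF G u k2] Gpq_connected[OF conn u k2] ne] unfolding R_def by metis
  let ?g = "\<lambda>v. x (Inl (Inl v))" and ?c = "\<lambda>l. x (line_vertex u t l)" and ?Z = "\<lambda>l j. x (line_inner t l j)"
  show ?thesis
  proof (rule that[of ?g ?c ?Z])
    show "?g u = ?c t" by (simp add: line_vertex_def path_vertex_def)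
    show "line_form E (s + t) ?g ?c ?Z = R * line_norm V u (s + t) ?g ?c ?Z"
      using x(2) unfolding form_Gpq[OF G u] knorm_Gpq[OF G u] .
    fix l assume l: "l \<le> s + t"
    have upd: "(\<lambda>v. (x(line_vertex u t l := r)) (Inl (Inl v))) = (if l = t then ?g(u := r) else ?g)"
      "(\<lambda>i. (x(line_vertex u t l := r)) (line_vertex u t i)) = ?c(l := r)" for r
      using line_vertex_inj[of u t] by (auto simp: fun_eq_iff line_vertex_def path_vertex_def inj_eq)
    have updZ: "(x(line_vertex u t l := r)) (line_inner t i j) = ?Z i j" if "j \<in> {2..k-1}" for r i j
      using that by (auto simp: line_vertex_def path_vertex_def line_inner_def)
    have "form (Gpq_E k E u s t) (x(line_vertex u t l := r))
        = line_form E (s + t) (if l = t then ?g(u := r) else ?g) (?c(l := r)) ?Z" for r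
      unfolding form_Gpq[OF G u] upd by (intro line_form_cong updZ)
    moreover have "knorm (Gpq_V k V s t) (x(line_vertex u t l := r))
        = line_norm V u (s + t) (if l = t then ?g(u := r) else ?g) (?c(l := r)) ?Z" for r
      unfolding knorm_Gpq[OF G u] upd by (intro line_norm_cong updZ)
    ultimately show "((\<lambda>r. R * line_norm V u (s + t) (if l = t then ?g(u := r) else ?g) (?c(l := r)) ?Z
        - line_form E (s + t) (if l = t then ?g(u := r) else ?g) (?c(l := r)) ?Z) has_real_derivative 0) (at (?c l))"
      using maximizer_critical(2)[OF Gpq_uniform[OF G u k2] x(3) _ x(2) line_vertex_in[OF u k2 l] x(1)] x(1)
      by (simp add: less_imp_le)
  qed (use x in auto)
qed

end

subsection \<open>Comparison of root positions\<close>

text \<open>Here \<open>s\<close> is the loss caused by varying the coordinate and \<open>D\<close>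
  the gain of the surgery. Since \<open>D - s\<close> has negative derivative at \<open>t0\<close>
  and is nonnegative there, it is positive slightly to the left; a short enough step keeps
  \<open>t\<close> positive.\<close>

lemma perturbation_gain:
  fixes s D :: "real \<Rightarrow> real"
  assumes s: "(s has_real_derivative 0) (at t0)" "s t0 = 0"
    and D: "(D has_real_derivative D1) (at t0)" "D1 < 0" "D t0 \<ge> 0" and t0: "t0 > 0"
  shows "\<exists>t>0. s t < D t"
proof -
  have "((\<lambda>t. D t - s t) has_real_derivative D1 - 0) (at t0)"
    by (intro derivative_intros s D)
  then have "((\<lambda>t. D t - s t) has_real_derivative D1) (at t0)" by simp
  from DERIV_neg_dec_left[OF this D(2)] obtain d
    where d: "d > 0" "\<And>h. h > 0 \<Longrightarrow> h < d \<Longrightarrow> D t0 - s t0 < D (t0 - h) - s (t0 - h)" by auto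
  define h where "h = min d t0 / 2"
  have "h > 0" "h < d" "h < t0" using d(1) t0 by (auto simp: h_def min_def)
  with d(2)[of h] s(2) D(3) show ?thesis by (intro exI[of _ "t0 - h"]) auto
qed

text \<open>Serves for vertices and for edges: as edge \<open>l\<close> joins \<open>l - 1\<close>
  and \<open>l\<close>, reversing the vertices \<open>L..M\<close> reverses the inner edges
  \<open>L + 1..M\<close>. On an empty range it is the identity.\<close>

definition reverse_on :: "nat \<Rightarrow> nat \<Rightarrow> nat \<Rightarrow> nat" where
  "reverse_on L M l = (if L \<le> l \<and> l \<le> M then L + M - l else l)"

lemma sum_reverse_on:
  assumes "{L..M} \<subseteq> A"
  shows "(\<Sum>l\<in>A. f (reverse_on L M l)) = (\<Sum>l\<in>A. f l)"
proof -
  have mem: "reverse_on L M l \<in> A" if "l \<in> A" for l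
    using that assms by (auto simp: reverse_on_def intro!: subsetD[OF assms])
  have "reverse_on L M (reverse_on L M l) = l" for l
    by (auto simp: reverse_on_def)
  then show ?thesis
    by (intro sum.reindex_bij_witness[of _ "reverse_on L M" "reverse_on L M"] mem) simp_all
qed

context alpha_form
begin

lemma line_norm_nonneg:
  assumes "\<And>v. 0 \<le> g v" "\<And>l. 0 \<le> c l" "\<And>l j. 0 \<le> Z l j"
  shows "0 \<le> line_norm V u N g c Z"
  unfolding line_norm_def using assms
  by (intro add_nonneg_nonneg sum_nonneg knorm_nonneg) auto

lemma line_norm_reverse:
  assumes "{L..M} \<subseteq> {..N}" "{L'..M'} \<subseteq> {1..N}"
  shows "line_norm V u N g (\<lambda>l. c (reverse_on L M l)) (\<lambda>l. Z (reverse_on L' M' l)) = line_norm V u N g c Z"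
  unfolding line_norm_def
  using sum_reverse_on[OF assms(1), of "\<lambda>l. c l ^ k"]
    sum_reverse_on[OF assms(2), of "\<lambda>l. \<Sum>j=2..k-1. Z l j ^ k"] by simp

text \<open>Only the two edges at the ends of the reversed segment change; they may receive arbitrary interiors.\<close>

lemma line_form_reverse:
  assumes "M < N" "L \<le> M" and Z': "\<And>l. l \<noteq> L \<Longrightarrow> l \<noteq> M + 1 \<Longrightarrow> Z' l = Z (reverse_on (L + 1) M l)"
  shows "line_form E N g (\<lambda>l. c (reverse_on L M l)) Z' = line_form E N g c Z
    + (if L = 0 then 0 else path_term (c (L - 1)) (c M) (Z' L) - path_term (c (L - 1)) (c L) (Z L))
    + (path_term (c L) (c (M + 1)) (Z' (M + 1)) - path_term (c M) (c (M + 1)) (Z (M + 1)))"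
proof -
  let ?c = "\<lambda>l. c (reverse_on L M l)"
  let ?P = "\<lambda>l. path_term (c (l - 1)) (c l) (Z l)" and ?Q = "\<lambda>l. path_term (?c (l - 1)) (?c l) (Z' l)"
  have same: "?Q l = ?P (reverse_on (L + 1) M l)" if l: "l \<in> {1..N}" "l \<notin> {L, M + 1}" for l
  proof (cases "L + 1 \<le> l \<and> l \<le> M")
    case True
    then have "reverse_on L M (l - 1) = L + 1 + M - l" "reverse_on L M l = L + 1 + M - l - 1"
      "reverse_on (L + 1) M l = L + 1 + M - l"
      by (auto simp: reverse_on_def)
    then show ?thesis using Z'[of l] l by (simp add: path_term_commute)
  next
    case False
    then have "reverse_on L M (l - 1) = l - 1" "reverse_on L M l = l" "reverse_on (L + 1) M l = l"
      using l assms(2) by (auto simp: reverse_on_def)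
    then show ?thesis using Z'[of l] l by simp
  qed
  \<comment> \<open>Reindexing the old sum by the edge reversal aligns each inner edge with its
    mirror image, so that termwise subtraction leaves only the edges \<open>L\<close> and
    \<open>M + 1\<close>.\<close>
  have "(\<Sum>l=1..N. ?Q l) - (\<Sum>l=1..N. ?P l) = (\<Sum>l=1..N. ?Q l) - (\<Sum>l=1..N. ?P (reverse_on (L + 1) M l))"
    using assms by (subst sum_reverse_on) auto
  also have "\<dots> = (\<Sum>l=1..N. ?Q l - ?P (reverse_on (L + 1) M l))"
    by (simp add: sum_subtractf)
  also have "\<dots> = (\<Sum>l\<in>{L, M + 1} \<inter> {1..N}. ?Q l - ?P (reverse_on (L + 1) M l))"
  proof (rule sum.mono_neutral_right)
    show "\<forall>l\<in>{1..N} - {L, M + 1} \<inter> {1..N}. ?Q l - ?P (reverse_on (L + 1) M l) = 0"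
      using same by fastforce
  qed auto
  also have "\<dots> = (if L = 0 then 0 else ?Q L - ?P L) + (?Q (M + 1) - ?P (M + 1))"
  proof -
    have "reverse_on (L + 1) M L = L" "reverse_on (L + 1) M (M + 1) = M + 1"
      by (auto simp: reverse_on_def)
    moreover have "{L, M + 1} \<inter> {1..N} = (if L = 0 then {M + 1} else {L, M + 1})"
      using assms by auto
    ultimately show ?thesis using assms(2) by (cases "L = 0") auto
  qed
  also have "?Q (M + 1) = path_term (c L) (c (M + 1)) (Z' (M + 1))"
    using assms by (auto simp: reverse_on_def)
  also have "(if L = 0 then 0 else ?Q L - ?P L)
      = (if L = 0 then 0 else path_term (c (L - 1)) (c M) (Z' L) - path_term (c (L - 1)) (c L) (Z L))"
    using assms by (auto simp: reverse_on_def)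
  finally show ?thesis unfolding line_form_def by simp
qed

section \<open>Strict gain of each surgery\<close>

lemma path_term_strict_mono:
  assumes "0 < a" "a < b" "0 < d" "\<And>j. 0 < z j"
  shows "path_term a d z < path_term b d z"
proof -
  have "a ^ k \<le> b ^ k" using assms by (intro power_mono) auto
  moreover have "a * d * (\<Prod>j=2..k-1. z j) < b * d * (\<Prod>j=2..k-1. z j)"
    using assms by (intro mult_strict_right_mono prod_pos) auto
  moreover have "(1 - \<alpha>) * real k > 0" using \<alpha>1 k2 by simp
  ultimately show ?thesis unfolding path_term_def
    using \<alpha>0 by (intro add_le_less_mono mult_left_mono mult_strict_left_mono) auto
qed

text \<open>After the move \<open>G\<close> sees the root value \<open>c p\<close>, while
  \<open>t\<close> stays free at position \<open>m\<close>; the gain over the unmoved configuration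
  is \<open>D t\<close>. It is nonnegative at \<open>c m\<close> because
  \<open>c m \<le> c p\<close>, and the edge at \<open>u\<close> makes its derivative negative. The
  norm is unaffected, as it omits the copy \<open>g u\<close>.\<close>

lemma gain_move_root:
  assumes G: "k_uniform_hypergraph k V E"
    and pos: "\<And>v. 0 < g v" "\<And>l. 0 < c l" and gu: "g u = c m"
    and eq: "line_form E N g c Z = R * line_norm V u N g c Z"
    and der: "((\<lambda>r. R * line_norm V u N (g(u := r)) (c(m := r)) Z
        - line_form E N (g(u := r)) (c(m := r)) Z) has_real_derivative 0) (at (c m))"
    and le: "c m \<le> c p" and e: "e \<in> E" "u \<in> e"
  shows "\<exists>t>0. R * line_norm V u N (g(u := c p)) (c(m := t)) Z < line_form E N (g(u := c p)) (c(m := t)) Z"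
proof -
  have finE: "finite E" by (rule finite_edges[OF G])
  have k0: "k > 0" using k2 by simp
  let ?s = "\<lambda>r. R * line_norm V u N (g(u := r)) (c(m := r)) Z - line_form E N (g(u := r)) (c(m := r)) Z"
  define d where "d = \<alpha> * real (hg_degree E u)"
  define B where "B = (1 - \<alpha>) * real k * link_sum E u g"
  have "link_sum E u g > 0"
    unfolding link_sum_def using finE e pos by (intro sum_pos prod_pos) auto
  then have B: "B > 0" unfolding B_def using \<alpha>1 k0 by simp
  have d: "d \<ge> 0" unfolding d_def using \<alpha>0 by simp
  define D where "D t = d * (c p ^ k - t ^ k) + B * (c p - t)" for t
  have D: "form E (g(u := c p)) - form E (g(u := t)) = D t" for t
  proof -
    have fe: "form E (g(u := r)) = form E g + (d * (r ^ k - g u ^ k) + B * (r - g u))" for r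
      using form_upd[OF finE edge_finite[OF G], of g u r] unfolding d_def B_def by (simp add: algebra_simps)
    show ?thesis unfolding D_def fe by (simp add: algebra_simps)
  qed
  have derD: "(D has_real_derivative - (d * (real k * c m ^ (k - 1)) + B)) (at (c m))"
    unfolding D_def by (auto intro!: derivative_eq_intros)
  have "g(u := c m) = g" using gu by (metis fun_upd_triv)
  then have "?s (c m) = 0" using eq by simp
  moreover have "- (d * (real k * c m ^ (k - 1)) + B) < 0"
    using add_nonneg_pos[of "d * (real k * c m ^ (k - 1))" B] d B pos(2)[of m] by simp
  moreover have "D (c m) \<ge> 0"
    unfolding D_def using d B le pos(2)[of m] by (simp add: power_mono)
  ultimately obtain t where t: "t > 0" "?s t < D t"
    using perturbation_gain[OF der _ derD] pos(2)[of m] by blast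
  have "line_norm V u N (g(u := c p)) (c(m := t)) Z = line_norm V u N (g(u := t)) (c(m := t)) Z"
  proof -
    have "knorm (V - {u}) (g(u := c p)) = knorm (V - {u}) (g(u := t))"
      by (rule knorm_cong) simp
    then show ?thesis unfolding line_norm_def by simp
  qed
  moreover have "line_form E N (g(u := c p)) (c(m := t)) Z = line_form E N (g(u := t)) (c(m := t)) Z + D t"
    unfolding line_form_def D[symmetric] by simp
  ultimately show ?thesis using t by (intro exI[of _ t]) auto
qed

text \<open>A segment starting at the free end has no edge to its left. Only the edge to
  \<open>c N\<close> changes, and it receives \<open>c 0\<close> in place of the smaller
  \<open>c M\<close>.\<close>

lemma gain_reverse_end:
  assumes pos: "\<And>l. 0 < c l" "\<And>l j. 0 < Z l j" and N: "M + 1 = N"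
    and eq: "line_form E N g c Z = R * line_norm V u N g c Z" and less: "c M < c 0"
  shows "R * line_norm V u N g (\<lambda>l. c (reverse_on 0 M l)) (\<lambda>l. Z (reverse_on 1 M l))
    < line_form E N g (\<lambda>l. c (reverse_on 0 M l)) (\<lambda>l. Z (reverse_on 1 M l))"
proof -
  have "reverse_on 1 M N = N" using N by (simp add: reverse_on_def)
  then have "line_form E N g (\<lambda>l. c (reverse_on 0 M l)) (\<lambda>l. Z (reverse_on 1 M l))
     = line_form E N g c Z + (path_term (c 0) (c N) (Z N) - path_term (c M) (c N) (Z N))"
    using line_form_reverse[of M N 0 "\<lambda>l. Z (reverse_on 1 M l)" Z E g c] N by simp
  moreover have "line_norm V u N g (\<lambda>l. c (reverse_on 0 M l)) (\<lambda>l. Z (reverse_on 1 M l)) = line_norm V u N g c Z"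
    using N by (intro line_norm_reverse) auto
  moreover have "path_term (c M) (c N) (Z N) < path_term (c 0) (c N) (Z N)"
    using pos less by (intro path_term_strict_mono) auto
  ultimately show ?thesis using eq by simp
qed

text \<open>The two changed edges together keep their end values and interiors, so all
  \<open>k\<close>-th powers cancel and only the products count. The varied coordinate
  \<open>t\<close> at \<open>L - 1\<close> enters these linearly, which gives a gain of the form
  \<open>\<kappa> * (A - t * B)\<close>.\<close>

lemma gain_reverse_inner:
  assumes pos: "\<And>l. 0 < c l" "\<And>l j. 0 < Z l j" and M: "M < N" and L: "1 \<le> L" "L \<le> M"
    and eq: "line_form E N g c Z = R * line_norm V u N g c Z"
    and der: "((\<lambda>r. R * line_norm V u N g (c(L - 1 := r)) Z
        - line_form E N g (c(L - 1 := r)) Z) has_real_derivative 0) (at (c (L - 1)))"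
    and less: "c M < c L" and le: "c (L - 1) \<le> c (M + 1)"
  shows "\<exists>t>0. \<exists>L' M'. R * line_norm V u N g (\<lambda>l. (c(L - 1 := t)) (reverse_on L M l)) (\<lambda>l. Z (reverse_on L' M' l))
    < line_form E N g (\<lambda>l. (c(L - 1 := t)) (reverse_on L M l)) (\<lambda>l. Z (reverse_on L' M' l))"
proof -
  let ?s = "\<lambda>r. R * line_norm V u N g (c(L - 1 := r)) Z - line_form E N g (c(L - 1 := r)) Z"
  define \<zeta> where "\<zeta> l = (\<Prod>j=2..k-1. Z l j)" for l
  have \<zeta>: "\<zeta> l > 0" for l unfolding \<zeta>_def using pos by (intro prod_pos) auto
  define \<kappa> where "\<kappa> = (1 - \<alpha>) * real k"
  have \<kappa>: "\<kappa> > 0" unfolding \<kappa>_def using \<alpha>1 k2 by simp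
  have pt: "path_term a b (Z l) = \<alpha> * (a ^ k + b ^ k + (\<Sum>j=2..k-1. Z l j ^ k)) + \<kappa> * (a * b * \<zeta> l)" for a b l
    by (simp add: path_term_def \<kappa>_def \<zeta>_def)
  have "\<exists>L' M' A B. 0 < B \<and> c (L - 1) * B \<le> A \<and> {L'..M'} \<subseteq> {1..N} \<and>
     (\<forall>l. l \<noteq> L \<longrightarrow> l \<noteq> M + 1 \<longrightarrow> reverse_on L' M' l = reverse_on (L + 1) M l) \<and>
     (\<forall>t. path_term t (c M) (Z (reverse_on L' M' L)) - path_term t (c L) (Z L)
       + (path_term (c L) (c (M + 1)) (Z (reverse_on L' M' (M + 1))) - path_term (c M) (c (M + 1)) (Z (M + 1)))
       = \<kappa> * (A - t * B))"
    \<comment> \<open>Exchanging the interiors of the two changed edges exactly when the product over edge \<open>L\<close>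
      is the larger one makes the gain factor with a nonnegative value at \<open>t = c (L - 1)\<close>.\<close>
  proof (cases "\<zeta> L \<le> \<zeta> (M + 1)")
    case True
    have r: "reverse_on (L + 1) M L = L" "reverse_on (L + 1) M (M + 1) = M + 1"
      by (auto simp: reverse_on_def)
    have "c (L - 1) * \<zeta> L \<le> c (M + 1) * \<zeta> (M + 1)"
      using le True \<zeta>[of L] pos(1)[of "M + 1"] by (intro mult_mono) auto
    then have "(c L - c M) * (c (L - 1) * \<zeta> L) \<le> (c L - c M) * (c (M + 1) * \<zeta> (M + 1))"
      using less by (intro mult_left_mono) auto
    then have le: "c (L - 1) * ((c L - c M) * \<zeta> L) \<le> (c L - c M) * (c (M + 1) * \<zeta> (M + 1))"
      by (simp add: mult_ac)
    show ?thesis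
    proof (rule exI[of _ "L + 1"], rule exI[of _ M], rule exI[of _ "(c L - c M) * (c (M + 1) * \<zeta> (M + 1))"],
        rule exI[of _ "(c L - c M) * \<zeta> L"], intro conjI allI impI)
      show "0 < (c L - c M) * \<zeta> L" using less \<zeta> by simp
    qed (use le M in \<open>auto simp: r[simplified] pt algebra_simps\<close>)
  next
    case False
    have r: "reverse_on L (M + 1) L = M + 1" "reverse_on L (M + 1) (M + 1) = L"
      using L by (auto simp: reverse_on_def)
    \<comment> \<open>Both reversals are \<open>l -> L + M + 1 - l\<close> on the inner edges;
      enlarging the range by one at each end merely adds the exchange of the edges \<open>L\<close>
      and \<open>M + 1\<close>.\<close>
    have r': "reverse_on L (M + 1) l = reverse_on (L + 1) M l" if "l \<noteq> L" "l \<noteq> M + 1" for l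
      using that by (auto simp: reverse_on_def)
    have B: "c M * \<zeta> (M + 1) < c L * \<zeta> L"
      using less False \<zeta>[of "M + 1"] pos(1)[of M] by (intro mult_strict_mono) auto
    then have "(c L * \<zeta> L - c M * \<zeta> (M + 1)) * c (L - 1) \<le> (c L * \<zeta> L - c M * \<zeta> (M + 1)) * c (M + 1)"
      using le by (intro mult_left_mono) auto
    then have le: "c (L - 1) * (c L * \<zeta> L - c M * \<zeta> (M + 1)) \<le> (c L * \<zeta> L - c M * \<zeta> (M + 1)) * c (M + 1)"
      by (simp add: mult.commute)
    show ?thesis
    proof (rule exI[of _ L], rule exI[of _ "M + 1"], rule exI[of _ "(c L * \<zeta> L - c M * \<zeta> (M + 1)) * c (M + 1)"],
        rule exI[of _ "c L * \<zeta> L - c M * \<zeta> (M + 1)"], intro conjI allI impI)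
      show "reverse_on L (M + 1) l = reverse_on (L + 1) M l" if "l \<noteq> L" "l \<noteq> M + 1" for l
        using that by (rule r')
    qed (use B le M L in \<open>auto simp: r[simplified] pt algebra_simps\<close>)
  qed
  then obtain L' M' A B where AB: "0 < B" "c (L - 1) * B \<le> A" "{L'..M'} \<subseteq> {1..N}"
    and r: "\<And>l. l \<noteq> L \<Longrightarrow> l \<noteq> M + 1 \<Longrightarrow> reverse_on L' M' l = reverse_on (L + 1) M l"
    and diff: "\<And>t. path_term t (c M) (Z (reverse_on L' M' L)) - path_term t (c L) (Z L)
       + (path_term (c L) (c (M + 1)) (Z (reverse_on L' M' (M + 1))) - path_term (c M) (c (M + 1)) (Z (M + 1)))
       = \<kappa> * (A - t * B)"
    by metis
  have derD: "((\<lambda>t. \<kappa> * (A - t * B)) has_real_derivative - (\<kappa> * B)) (at (c (L - 1)))"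
    by (auto intro!: derivative_eq_intros)
  have "?s (c (L - 1)) = 0" using eq by simp
  moreover have "- (\<kappa> * B) < 0" using \<kappa> AB by simp
  moreover have "0 \<le> \<kappa> * (A - c (L - 1) * B)" using \<kappa> AB by simp
  ultimately obtain t where t: "t > 0" "?s t < \<kappa> * (A - t * B)"
    using perturbation_gain[OF der _ derD] pos(1) by blast
  let ?c = "c(L - 1 := t)" and ?Z = "\<lambda>l. Z (reverse_on L' M' l)"
  have "line_norm V u N g (\<lambda>l. ?c (reverse_on L M l)) ?Z = line_norm V u N g ?c Z"
    using AB M by (intro line_norm_reverse) auto
  moreover have "line_form E N g (\<lambda>l. ?c (reverse_on L M l)) ?Z = line_form E N g ?c Z + \<kappa> * (A - t * B)"
  proof -
    have "?c (L - 1) = t" "?c L = c L" "?c M = c M" "?c (M + 1) = c (M + 1)" using L by auto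
    then show ?thesis
      using line_form_reverse[of M N L ?Z Z E g ?c] r M L unfolding diff[symmetric]
      by simp
  qed
  ultimately show ?thesis using t by (intro exI[of _ t] conjI exI[of _ L'] exI[of _ M']) auto
qed

end

text \<open>A path from \<open>u\<close> to a vertex of some edge is either trivial, so that this
  edge contains \<open>u\<close>, or begins inside an edge at \<open>u\<close>.\<close>

lemma vertex_in_edge:
  assumes "k_uniform_hypergraph k V E" "hg_connected V E" "E \<noteq> {}" "u \<in> V" "k \<ge> 1"
  obtains e where "e \<in> E" "u \<in> e"
proof -
  obtain e0 where e0: "e0 \<in> E" using assms(3) by auto
  then have "e0 \<noteq> {}" "e0 \<subseteq> V" using assms unfolding k_uniform_hypergraph_def by force+
  then obtain w where w: "w \<in> e0" "w \<in> V" by auto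
  then have "(u, w) \<in> (hg_adj E)\<^sup>*" using assms unfolding hg_connected_def by auto
  then show ?thesis
  proof (cases rule: converse_rtranclE)
    case base
    then show ?thesis using that e0 w by auto
  next
    case (step y)
    then show ?thesis using that unfolding hg_adj_def by auto
  qed
qed

theorem theorem4p3:
  fixes k :: nat and \<alpha> :: real and V :: "'a set" and E :: "'a set set" and u :: 'a
    and p q :: nat
  assumes "k \<ge> 2" and "0 \<le> \<alpha>" and "\<alpha> < 1"
    and "k_uniform_hypergraph k V E" and "hg_connected V E" and "E \<noteq> {}"
    and "u \<in> V" and "q \<ge> 1" and "p \<ge> q"
  shows "rho_alpha k \<alpha> (Gpq_V k V p q) (Gpq_E k E u p q)
           > rho_alpha k \<alpha> (Gpq_V k V (p + 1) (q - 1)) (Gpq_E k E u (p + 1) (q - 1))"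
proof -
  interpret alpha_form k \<alpha> by unfold_locales fact+
  note G = assms(4) and conn = assms(5) and u = assms(7)
  let ?R1 = "rho_alpha k \<alpha> (Gpq_V k V p q) (Gpq_E k E u p q)"
  define m where "m = q - 1"
  define R where "R = rho_alpha k \<alpha> (Gpq_V k V (p + 1) m) (Gpq_E k E u (p + 1) m)"
  define N where "N = p + q"
  have N: "p + 1 + m = N" "m < p" "m \<le> N" "N = m + p + 1" using assms(8,9) by (auto simp: N_def m_def)
  obtain g c Z where
    pos: "\<And>v. 0 < g v" "\<And>l. 0 < c l" "\<And>l j. 0 < Z l j" and gu: "g u = c m"
    and eq: "line_form E N g c Z = R * line_norm V u N g c Z"
    and der: "\<And>l. l \<le> N \<Longrightarrow> ((\<lambda>r. R * line_norm V u N (if l = m then g(u := r) else g) (c(l := r)) Z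
        - line_form E N (if l = m then g(u := r) else g) (c(l := r)) Z) has_real_derivative 0) (at (c l))"
    by (rule line_perron[OF G conn u, where s = "p + 1" and t = m, folded R_def, unfolded N(1)])
      (rule that; fast)
  \<comment> \<open>Reduces the theorem to finding one nonnegative vector with the root at position
    \<open>p\<close> whose form exceeds \<open>R\<close> times its norm.\<close>
  have gain: "R < ?R1"
    if "\<And>v. 0 \<le> g' v" "\<And>l. 0 \<le> c' l" "\<And>l j. 0 \<le> Z' l j" "g' u = c' p"
      "R * line_norm V u N g' c' Z' < line_form E N g' c' Z'" for g' c' Z'
  proof (rule ccontr)
    assume "\<not> R < ?R1"
    then have "?R1 * line_norm V u N g' c' Z' \<le> R * line_norm V u N g' c' Z'"
      using that by (intro mult_right_mono line_norm_nonneg) auto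
    moreover have "line_form E N g' c' Z' \<le> ?R1 * line_norm V u N g' c' Z'"
      unfolding N_def by (rule line_bound_reflect) (use G conn u that in auto)
    ultimately show False using that(5) by linarith
  qed
  have "R < ?R1"
  proof (cases "c m \<le> c p")
    case True
    have "k \<ge> 1" using assms(1) by simp
    then obtain e where e: "e \<in> E" "u \<in> e"
      by (rule vertex_in_edge[OF G conn assms(6) u])
    have "((\<lambda>r. R * line_norm V u N (g(u := r)) (c(m := r)) Z
        - line_form E N (g(u := r)) (c(m := r)) Z) has_real_derivative 0) (at (c m))"
      using der[OF N(3)] by simp
    from gain_move_root[OF G pos(1,2) gu eq this True e] obtain t where t: "t > 0" "R * line_norm V u N (g(u := c p)) (c(m := t)) Z
        < line_form E N (g(u := c p)) (c(m := t)) Z"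
      by auto
    show ?thesis
      by (rule gain[OF _ _ _ _ t(2)]) (use t(1) pos N in \<open>auto simp: less_imp_le\<close>)
  next
    case False
    define L where "L = (LEAST l. c (N - 1 - l) < c l)"
    \<comment> \<open>Because \<open>N - 1 - m = p\<close>, the failure of
      \<open>c m \<le> c p\<close> makes \<open>m\<close> a candidate for the minimum.\<close>
    have "c (N - 1 - m) < c m" using False N by simp
    then have L: "c (N - 1 - L) < c L" "L \<le> m"
      unfolding L_def by (auto intro: LeastI Least_le)
    define M where "M = N - 1 - L"
    have M: "M + L + 1 = N" "L \<le> M" "p \<le> M" using L N by (auto simp: M_def)
    \<comment> \<open>The segment contains \<open>p\<close>, and
      \<open>L + M - p = N - 1 - p = m\<close>.\<close>
    have rev_p: "reverse_on L M p = m" using M N L by (auto simp: reverse_on_def)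
    show ?thesis
    proof (cases "L = 0")
      case True
      show ?thesis
      proof (rule gain[OF _ _ _ _ gain_reverse_end[OF pos(2,3) _ eq]])
        show "M + 1 = N" "c M < c 0" using True M L by (auto simp: M_def)
        show "g u = c (reverse_on 0 M p)" using rev_p True gu by simp
      qed (use pos in \<open>auto simp: less_imp_le\<close>)
    next
      case False
      then have "L - 1 < L" by simp
      then have "\<not> c (N - 1 - (L - 1)) < c (L - 1)" unfolding L_def by (rule not_less_Least)
      moreover have "N - 1 - (L - 1) = M + 1" using False M by auto
      ultimately have le: "c (L - 1) \<le> c (M + 1)" by simp
      \<comment> \<open>As \<open>L - 1 < m\<close>, the varied vertex is not the root, so
        \<open>g\<close> stays fixed in the derivative and the root value survives the
        variation.\<close>
      have "L - 1 \<noteq> m" "L - 1 \<le> N" using L False N by auto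
      with der[of "L - 1"] have
        "((\<lambda>r. R * line_norm V u N g (c(L - 1 := r)) Z
          - line_form E N g (c(L - 1 := r)) Z) has_real_derivative 0) (at (c (L - 1)))"
        by simp
      from gain_reverse_inner[OF pos(2,3) _ _ M(2) eq this _ le] False M(1) L(1)[folded M_def]
      obtain t L' M' where t: "t > 0"
        "R * line_norm V u N g (\<lambda>l. (c(L - 1 := t)) (reverse_on L M l)) (\<lambda>l. Z (reverse_on L' M' l))
          < line_form E N g (\<lambda>l. (c(L - 1 := t)) (reverse_on L M l)) (\<lambda>l. Z (reverse_on L' M' l))"
        by auto
      show ?thesis
      proof (rule gain[OF _ _ _ _ t(2)])
        show "g u = (c(L - 1 := t)) (reverse_on L M p)"
          using rev_p gu \<open>L - 1 \<noteq> m\<close> by simp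
      qed (use t(1) pos in \<open>auto simp: less_imp_le\<close>)
    qed
  qed
  then show ?thesis unfolding R_def m_def .
qed

end
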